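(* (a) Let $R$ be a ring and let $F$ be a free $R$-module of infinite rank. Then the endomorphism ring $\mathrm{End}_R(F)$ is a sum of three nilpotent subrings of nilpotency index $3$. Consequently, there exist three braceable subtrusses $K,L,M$ of the truss $T(\mathrm{End}_R(F))$ such that $\mathrm{End}_R(F)=[K,L,M]$. (b) Let $V$ be an infinite dimensional vector space over a field $\mathbb{F}$, and let $$I=\{f\in \mathrm{End}_{\mathbb{F}}(V)\mid \dim_{\mathbb{F}}(\mathrm{Im}(f))<\dim_{\mathbb{F}}(V)\}$$ be the maximal ideal of $\mathrm{End}_{\mathbb{F}}(V)$. Then the simple ring $\mathrm{End}_{\mathbb{F}}(V)/I$ is a sum of three nilpotent subrings of nilpotency index $3$. Consequently, there exist three braceable subtrusses $K,L,M$ of the truss $T(\mathrm{End}_{\mathbb{F}}(V)/I)$ such that $\mathrm{End}_{\mathbb{F}}(V)/I=[K,L,M]$.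
   Context: All rings are unital and associative, but subrings are not required to contain the identity. A subring $S$ of a ring is nilpotent of nilpotency index $k$ if $S^k=0$ but $S^{k-1}\neq 0$. A ring $Q$ is a sum of three subrings $S_1,S_2,S_3$ if $Q=S_1+S_2+S_3$ (every element of $Q$ is a sum $s_1+s_2+s_3$ with $s_i\in S_i$). A truss is a triple $(T,[-,-,-],\cdot)$, where $[-,-,-]$ is a ternary operation on the set $T$ for which there exists an abelian group structure $(T,+)$ with $[x,y,z]=x-y+z$ for all $x,y,z\in T$, and $\cdot$ is an associative binary operation on $T$ that distributes over $[-,-,-]$ on both sides: $w\cdot[x,y,z]=[w\cdot x,w\cdot y,w\cdot z]$ and $[x,y,z]\cdot w=[x\cdot w,y\cdot w,z\cdot w]$. A subtruss of $T$ is a subset $S\subseteq T$ closed under the operations $[-,-,-]$ and $\cdot$. A truss is braceable if $(T,\cdot)$ is a group; a braceable subtruss is a subtruss that is braceable as a truss. To every ring $(Q,+,\cdot)$ one associates the truss $T(Q)=(Q,[-,-,-],\cdot)$ with $[x,y,z]=x-y+z$. For subsets $X,Y,Z$ of a truss, $[X,Y,Z]=\{[x,y,z]\mid x\in X,\ y\in Y,\ z\in Z\}$. *)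

theory Defs
  imports "HOL-Algebra.Ideal_Product" "HOL-Algebra.QuotRing" "HOL-Algebra.Module"
begin

unbundle cardinal_syntax

section \<open>Modules over rings that need not be commutative\<close>

text \<open>The library's locale \<^locale>\<open>module\<close> requires a commutative ring of scalars.\<close>

locale left_module = R?: ring R + M?: abelian_group M
  for R :: "('a, 'k) ring_scheme" (structure) and M :: "('a, 'b, 'm) module_scheme" (structure) +
  assumes smult_closed [simp, intro]:
      "\<lbrakk>a \<in> carrier R; x \<in> carrier M\<rbrakk> \<Longrightarrow> a \<odot>\<^bsub>M\<^esub> x \<in> carrier M"
    and smult_l_distr:
      "\<lbrakk>a \<in> carrier R; b \<in> carrier R; x \<in> carrier M\<rbrakk> \<Longrightarrow>
        (a \<oplus>\<^bsub>R\<^esub> b) \<odot>\<^bsub>M\<^esub> x = a \<odot>\<^bsub>M\<^esub> x \<oplus>\<^bsub>M\<^esub> b \<odot>\<^bsub>M\<^esub> x"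
    and smult_r_distr:
      "\<lbrakk>a \<in> carrier R; x \<in> carrier M; y \<in> carrier M\<rbrakk> \<Longrightarrow>
        a \<odot>\<^bsub>M\<^esub> (x \<oplus>\<^bsub>M\<^esub> y) = a \<odot>\<^bsub>M\<^esub> x \<oplus>\<^bsub>M\<^esub> a \<odot>\<^bsub>M\<^esub> y"
    and smult_assoc1:
      "\<lbrakk>a \<in> carrier R; b \<in> carrier R; x \<in> carrier M\<rbrakk> \<Longrightarrow>
        (a \<otimes>\<^bsub>R\<^esub> b) \<odot>\<^bsub>M\<^esub> x = a \<odot>\<^bsub>M\<^esub> (b \<odot>\<^bsub>M\<^esub> x)"
    and smult_one [simp]:
      "x \<in> carrier M \<Longrightarrow> \<one>\<^bsub>R\<^esub> \<odot>\<^bsub>M\<^esub> x = x"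

definition module_basis ::
  "('a, 'k) ring_scheme \<Rightarrow> ('a, 'b, 'm) module_scheme \<Rightarrow> 'b set \<Rightarrow> bool" where
  "module_basis R M B \<longleftrightarrow>
     B \<subseteq> carrier M \<and>
     (\<forall>x\<in>carrier M. \<exists>A a. finite A \<and> A \<subseteq> B \<and> a \<in> A \<rightarrow> carrier R \<and>
        x = finsum M (\<lambda>b. a b \<odot>\<^bsub>M\<^esub> b) A) \<and>
     (\<forall>A a. finite A \<longrightarrow> A \<subseteq> B \<longrightarrow> a \<in> A \<rightarrow> carrier R \<longrightarrow>
        finsum M (\<lambda>b. a b \<odot>\<^bsub>M\<^esub> b) A = \<zero>\<^bsub>M\<^esub> \<longrightarrow> (\<forall>b\<in>A. a b = \<zero>\<^bsub>R\<^esub>))"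

text \<open>A basis is a set of elements, so over the zero ring no module satisfies the
  following predicate: nontriviality of the ring is implied by it.\<close>

definition free_of_infinite_rank ::
  "('a, 'k) ring_scheme \<Rightarrow> ('a, 'b, 'm) module_scheme \<Rightarrow> bool" where
  "free_of_infinite_rank R M \<longleftrightarrow> (\<exists>B. module_basis R M B \<and> infinite B)"

text \<open>The dimension of a vector space as a cardinal, possibly infinite. It is to be compared
  with \<open><o\<close> and \<open>=o\<close>, being determined by the space only up to \<open>=o\<close>.\<close>

definition vs_dim ::
  "('a, 'k) ring_scheme \<Rightarrow> ('a, 'b, 'm) module_scheme \<Rightarrow> 'b rel" where
  "vs_dim K V = |SOME B. module_basis K V B|"


section \<open>The endomorphism ring\<close>

text \<open>Endomorphisms are extensional, so that equality of elements of the ring is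
  equality of maps on the module. Multiplication is \<open>f g = f \<circ> g\<close>.\<close>

definition module_endos ::
  "('a, 'k) ring_scheme \<Rightarrow> ('a, 'b, 'm) module_scheme \<Rightarrow> ('b \<Rightarrow> 'b) set" where
  "module_endos R M =
     {f \<in> extensional (carrier M). f \<in> hom (add_monoid M) (add_monoid M) \<and>
        (\<forall>a\<in>carrier R. \<forall>x\<in>carrier M. f (a \<odot>\<^bsub>M\<^esub> x) = a \<odot>\<^bsub>M\<^esub> f x)}"

definition End_ring ::
  "('a, 'k) ring_scheme \<Rightarrow> ('a, 'b, 'm) module_scheme \<Rightarrow> ('b \<Rightarrow> 'b) ring" where
  "End_ring R M =
     \<lparr>carrier = module_endos R M,
      mult = compose (carrier M),
      one = (\<lambda>x\<in>carrier M. x),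
      zero = (\<lambda>x\<in>carrier M. \<zero>\<^bsub>M\<^esub>),
      add = (\<lambda>f g. \<lambda>x\<in>carrier M. f x \<oplus>\<^bsub>M\<^esub> g x)\<rparr>"

definition small_image_ideal ::
  "('a, 'k) ring_scheme \<Rightarrow> ('a, 'b, 'm) module_scheme \<Rightarrow> ('b \<Rightarrow> 'b) set" where
  "small_image_ideal K V =
     {f \<in> carrier (End_ring K V). vs_dim K (V\<lparr>carrier := f ` carrier V\<rparr>) <o vs_dim K V}"

definition simple_ring :: "('a, 'k) ring_scheme \<Rightarrow> bool" where
  "simple_ring Q \<longleftrightarrow> ring Q \<and> \<one>\<^bsub>Q\<^esub> \<noteq> \<zero>\<^bsub>Q\<^esub> \<and>
     (\<forall>J. ideal J Q \<longrightarrow> J = {\<zero>\<^bsub>Q\<^esub>} \<or> J = carrier Q)"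


section \<open>Nilpotent subrings\<close>

text \<open>Unlike the library's \<open>subring\<close>, these subrings need not contain the identity.\<close>

definition nonunital_subring :: "'a set \<Rightarrow> ('a, 'k) ring_scheme \<Rightarrow> bool" where
  "nonunital_subring S Q \<longleftrightarrow> subgroup S (add_monoid Q) \<and>
     (\<forall>x\<in>S. \<forall>y\<in>S. x \<otimes>\<^bsub>Q\<^esub> y \<in> S)"

text \<open>\<^const>\<open>ideal_prod\<close> is the set of nonempty finite sums of products. The zeroth power is
  a convention; it matters only for the index of the zero subring.\<close>

fun subring_power :: "('a, 'k) ring_scheme \<Rightarrow> 'a set \<Rightarrow> nat \<Rightarrow> 'a set" where
  "subring_power Q S 0 = carrier Q"
| "subring_power Q S (Suc 0) = S"
| "subring_power Q S (Suc (Suc n)) = ideal_prod Q (subring_power Q S (Suc n)) S"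

definition nilpotent_subring :: "'a set \<Rightarrow> nat \<Rightarrow> ('a, 'k) ring_scheme \<Rightarrow> bool" where
  "nilpotent_subring S k Q \<longleftrightarrow> nonunital_subring S Q \<and>
     subring_power Q S k = {\<zero>\<^bsub>Q\<^esub>} \<and> subring_power Q S (k - 1) \<noteq> {\<zero>\<^bsub>Q\<^esub>}"

definition sum_of_three_nilpotent_subrings :: "nat \<Rightarrow> ('a, 'k) ring_scheme \<Rightarrow> bool" where
  "sum_of_three_nilpotent_subrings k Q \<longleftrightarrow>
     (\<exists>S1 S2 S3. nilpotent_subring S1 k Q \<and> nilpotent_subring S2 k Q \<and>
        nilpotent_subring S3 k Q \<and>
        carrier Q = S1 <+>\<^bsub>Q\<^esub> S2 <+>\<^bsub>Q\<^esub> S3)"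


section \<open>Trusses\<close>

record 'a truss = "'a partial_object" +
  heap :: "'a \<Rightarrow> 'a \<Rightarrow> 'a \<Rightarrow> 'a"
  tmult :: "'a \<Rightarrow> 'a \<Rightarrow> 'a"

definition is_truss :: "('a, 't) truss_scheme \<Rightarrow> bool" where
  "is_truss T \<longleftrightarrow>
     (\<exists>G :: 'a monoid. comm_group G \<and> carrier G = carrier T \<and>
        (\<forall>x\<in>carrier T. \<forall>y\<in>carrier T. \<forall>z\<in>carrier T.
           heap T x y z = x \<otimes>\<^bsub>G\<^esub> inv\<^bsub>G\<^esub> y \<otimes>\<^bsub>G\<^esub> z)) \<and>
     (\<forall>x\<in>carrier T. \<forall>y\<in>carrier T. tmult T x y \<in> carrier T) \<and>
     (\<forall>x\<in>carrier T. \<forall>y\<in>carrier T. \<forall>z\<in>carrier T.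
        tmult T (tmult T x y) z = tmult T x (tmult T y z)) \<and>
     (\<forall>w\<in>carrier T. \<forall>x\<in>carrier T. \<forall>y\<in>carrier T. \<forall>z\<in>carrier T.
        tmult T w (heap T x y z) = heap T (tmult T w x) (tmult T w y) (tmult T w z) \<and>
        tmult T (heap T x y z) w = heap T (tmult T x w) (tmult T y w) (tmult T z w))"

definition subtruss :: "'a set \<Rightarrow> ('a, 't) truss_scheme \<Rightarrow> bool" where
  "subtruss S T \<longleftrightarrow> is_truss T \<and> S \<subseteq> carrier T \<and>
     (\<forall>x\<in>S. \<forall>y\<in>S. \<forall>z\<in>S. heap T x y z \<in> S) \<and>
     (\<forall>x\<in>S. \<forall>y\<in>S. tmult T x y \<in> S)"

definition braceable :: "('a, 't) truss_scheme \<Rightarrow> bool" where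
  "braceable T \<longleftrightarrow> is_truss T \<and>
     (\<exists>e. group \<lparr>carrier = carrier T, mult = tmult T, one = e\<rparr>)"

text \<open>The identity element of a braceable subtruss is its own; it need not be an
  identity of the ambient truss.\<close>

definition braceable_subtruss :: "'a set \<Rightarrow> ('a, 't) truss_scheme \<Rightarrow> bool" where
  "braceable_subtruss S T \<longleftrightarrow> subtruss S T \<and> braceable (T\<lparr>carrier := S\<rparr>)"

definition ring_truss :: "('a, 'k) ring_scheme \<Rightarrow> 'a truss" where
  "ring_truss Q =
     \<lparr>carrier = carrier Q,
      heap = (\<lambda>x y z. x \<ominus>\<^bsub>Q\<^esub> y \<oplus>\<^bsub>Q\<^esub> z),
      tmult = (\<lambda>x y. x \<otimes>\<^bsub>Q\<^esub> y)\<rparr>"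

definition heap_set :: "('a, 't) truss_scheme \<Rightarrow> 'a set \<Rightarrow> 'a set \<Rightarrow> 'a set \<Rightarrow> 'a set" where
  "heap_set T X Y Z = {heap T x y z | x y z. x \<in> X \<and> y \<in> Y \<and> z \<in> Z}"

end

theory Submission
  imports Defs
begin

text \<open>A free module \<open>F\<close> of infinite rank is isomorphic to \<open>F\<^sup>3\<close>, so its endomorphism ring \<open>Q\<close>
  is isomorphic to the ring of \<open>3 \<times> 3\<close> matrices over \<open>Q\<close>. There the strictly upper and the
  strictly lower triangular matrices are nilpotent of index 3, and together they give all
  matrices with zero diagonal. What remains is a third nilpotent subring of index 3 in which
  every diagonal occurs. Over a nonzero commutative ring the trace forbids this, since nilpotent
  matrices over a residue field have trace zero. Here, however, the trace is no obstruction, because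
  \<open>Q\<close> contains an element \<open>a\<close>, a backward shift, such that every element of \<open>Q\<close> has the form
  \<open>a z - z a\<close> (lemma \<open>backward_shift\<close>). A conjugate of the strictly upper triangular matrices
  by a suitable invertible matrix with entries \<open>0, 1, a\<close> does the job (lemma
  \<open>slanted_diagonal\<close>).

  The hypotheses of this argument are finitely many equations in \<open>Q\<close> and the solvability of
  \<open>a z - z a = d\<close>. They are inherited by every nonzero quotient of \<open>Q\<close>, which settles the
  decomposition in the second part. The remaining claim there is that the endomorphisms of
  small image form the only maximal ideal \<open>I\<close>. An endomorphism \<open>f\<close> lies outside \<open>I\<close> exactly
  if \<open>g f h = 1\<close> for some \<open>g, h\<close> (lemmas \<open>factor_one\<close> and \<open>I_factor\<close>), so a proper ideal is
  contained in \<open>I\<close>; closure of \<open>I\<close> under addition is cardinal arithmetic with bases.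

  The statements on trusses follow in any ring: if \<open>S\<close> is a nilpotent subring, then \<open>1 + S\<close>
  is a group under multiplication and closed under \<open>x - y + z\<close>.\<close>

section \<open>Three nilpotent subrings of a matrix ring\<close>

text \<open>For a matrix \<open>g \<in> GL\<^sub>3\<close> with first two columns \<open>c1, c2\<close> whose inverse has last two
  rows \<open>h2, h3\<close>, this is \<open>g N g\<^sup>-\<^sup>1\<close> for the ring \<open>N\<close> of strictly upper triangular
  matrices: the maps that move each member of the flag of \<open>g\<close> into the previous one.\<close>

definition flag_subring :: "('a, 'k) ring_scheme \<Rightarrow> 'a \<Rightarrow> 'a \<Rightarrow> 'a \<Rightarrow> 'a \<Rightarrow> 'a set" where
  "flag_subring Q c1 c2 h2 h3 =
     {c1 \<otimes>\<^bsub>Q\<^esub> x \<otimes>\<^bsub>Q\<^esub> h2 \<oplus>\<^bsub>Q\<^esub> c1 \<otimes>\<^bsub>Q\<^esub> y \<otimes>\<^bsub>Q\<^esub> h3 \<oplus>\<^bsub>Q\<^esub> c2 \<otimes>\<^bsub>Q\<^esub> z \<otimes>\<^bsub>Q\<^esub> h3 | x y z.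
        x \<in> carrier Q \<and> y \<in> carrier Q \<and> z \<in> carrier Q}"

text \<open>Sorting a sum puts \<open>x\<close> and \<open>\<ominus> x\<close> at a distance from each other, while \<open>r_neg1\<close> and
  \<open>r_neg2\<close> cancel neighbours.\<close>

lemma (in abelian_group) cancel_skip:
  assumes "x \<in> carrier G" "y \<in> carrier G" "z \<in> carrier G" "u \<in> carrier G"
    "v \<in> carrier G"
  shows "x \<oplus> (y \<oplus> (\<ominus> x \<oplus> z)) = y \<oplus> z" "x \<oplus> (y \<oplus> \<ominus> x) = y"
    "x \<oplus> (y \<oplus> (z \<oplus> (\<ominus> x \<oplus> u))) = y \<oplus> (z \<oplus> u)" "x \<oplus> (y \<oplus> (z \<oplus> \<ominus> x)) = y \<oplus> z"
    "x \<oplus> (y \<oplus> (z \<oplus> (u \<oplus> (\<ominus> x \<oplus> v)))) = y \<oplus> (z \<oplus> (u \<oplus> v))"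
    "x \<oplus> (y \<oplus> (z \<oplus> (u \<oplus> \<ominus> x))) = y \<oplus> (z \<oplus> u)"
  using assms
  by (simp_all add: a_lcomm[of x y] a_lcomm[of x z] a_lcomm[of x u] a_comm[of x "\<ominus> x"] r_neg r_neg1 r_neg2)

lemma (in ring) nilpotent_subring_3I:
  assumes S: "nonunital_subring S R"
    and cube: "\<And>x y z. \<lbrakk>x \<in> S; y \<in> S; z \<in> S\<rbrakk> \<Longrightarrow> x \<otimes> y \<otimes> z = \<zero>"
    and square: "u \<in> S" "v \<in> S" "u \<otimes> v \<noteq> \<zero>"
  shows "nilpotent_subring S 3 R"
proof -
  have sub: "S \<subseteq> carrier R"
    using S subgroup.subset[of S "add_monoid R"] by (auto simp: nonunital_subring_def)
  have 0: "\<zero> \<in> S"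
    using S subgroup.one_closed[of S "add_monoid R"] by (auto simp: nonunital_subring_def)
  have SS: "s \<in> carrier R \<and> (\<forall>z\<in>S. s \<otimes> z = \<zero>)" if "s \<in> ideal_prod R S S" for s
    using that
  proof induction
    case (prod i j)
    then show ?case using cube sub by auto
  next
    case (sum s1 s2)
    then show ?case using sub by (auto simp: l_distr subset_iff)
  qed
  have "s = \<zero>" if "s \<in> ideal_prod R (ideal_prod R S S) S" for s
    using that
  proof induction
    case (prod i j)
    then show ?case using SS by blast
  next
    case (sum s1 s2)
    then show ?case by (metis l_zero zero_closed)
  qed
  moreover have "\<zero> \<otimes> \<zero> \<otimes> \<zero> \<in> ideal_prod R (ideal_prod R S S) S"
    using 0 by (intro ideal_prod.prod)
  then have "\<zero> \<in> ideal_prod R (ideal_prod R S S) S" by simp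
  ultimately have "ideal_prod R (ideal_prod R S S) S = {\<zero>}"
    by blast
  moreover have "u \<otimes> v \<in> ideal_prod R S S"
    using square by (intro ideal_prod.prod)
  ultimately show ?thesis
    using S square by (auto simp: nilpotent_subring_def numeral_3_eq_3 numeral_2_eq_2)
qed

text \<open>The relations make the product of two elements a multiple \<open>c1 w h3\<close> of the corner entry
  alone, and annihilate a third factor. The unit \<open>h2 c2 = 1\<close> makes the corner reachable.\<close>

lemma (in ring) flag_subring_nilpotent:
  assumes closed [simp]: "c1 \<in> carrier R" "c2 \<in> carrier R" "h2 \<in> carrier R" "h3 \<in> carrier R"
    and rel: "h2 \<otimes> c1 = \<zero>" "h3 \<otimes> c1 = \<zero>" "h3 \<otimes> c2 = \<zero>" "h2 \<otimes> c2 = \<one>"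
    and nz: "c1 \<otimes> h3 \<noteq> \<zero>"
  shows "nilpotent_subring (flag_subring R c1 c2 h2 h3) 3 R"
proof -
  let ?S = "flag_subring R c1 c2 h2 h3"
  define el where "el x y z = c1 \<otimes> x \<otimes> h2 \<oplus> c1 \<otimes> y \<otimes> h3 \<oplus> c2 \<otimes> z \<otimes> h3" for x y z
  have el_closed [simp]: "el x y z \<in> carrier R"
    if "x \<in> carrier R" "y \<in> carrier R" "z \<in> carrier R" for x y z
    using that by (simp add: el_def)
  have S_def: "?S = {el x y z | x y z. x \<in> carrier R \<and> y \<in> carrier R \<and> z \<in> carrier R}"
    by (simp add: flag_subring_def el_def)
  have elI: "el x y z \<in> ?S"
    if "x \<in> carrier R" "y \<in> carrier R" "z \<in> carrier R" for x y z
    using that by (auto simp: S_def)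
  have el_zero: "el \<zero> \<zero> \<zero> = \<zero>"
    by (simp add: el_def)
  have el_add: "el x y z \<oplus> el x' y' z' = el (x \<oplus> x') (y \<oplus> y') (z \<oplus> z')"
    if "x \<in> carrier R" "y \<in> carrier R" "z \<in> carrier R" "x' \<in> carrier R" "y' \<in> carrier R" "z' \<in> carrier R"
    for x y z x' y' z'
    using that by (simp add: el_def l_distr r_distr a_ac)
  have el_neg: "\<ominus> el x y z = el (\<ominus> x) (\<ominus> y) (\<ominus> z)"
    if "x \<in> carrier R" "y \<in> carrier R" "z \<in> carrier R" for x y z
    using that by (simp add: el_def minus_add l_minus r_minus)
  have rel': "h2 \<otimes> (c1 \<otimes> x) = \<zero>" "h3 \<otimes> (c1 \<otimes> x) = \<zero>" "h3 \<otimes> (c2 \<otimes> x) = \<zero>" "h2 \<otimes> (c2 \<otimes> x) = x"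
    if "x \<in> carrier R" for x
    using that by (simp_all add: rel flip: m_assoc)
  have el_mult: "el x y z \<otimes> el x' y' z' = el \<zero> (x \<otimes> z') \<zero>"
    if "x \<in> carrier R" "y \<in> carrier R" "z \<in> carrier R" "x' \<in> carrier R" "y' \<in> carrier R" "z' \<in> carrier R"
    for x y z x' y' z'
    using that by (simp add: el_def l_distr r_distr m_assoc rel')
  have "subgroup ?S (add_monoid R)"
  proof (rule add.subgroupI)
    show "?S \<subseteq> carrier R" by (auto simp: S_def)
    show "?S \<noteq> {}" using elI by blast
  next
    fix s assume "s \<in> ?S"
    then obtain x y z where "s = el x y z" "x \<in> carrier R" "y \<in> carrier R" "z \<in> carrier R"
      by (auto simp: S_def)
    then show "\<ominus> s \<in> ?S" by (simp add: el_neg elI)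
  next
    fix s t assume "s \<in> ?S" "t \<in> ?S"
    then obtain x y z x' y' z' where "s = el x y z" "x \<in> carrier R" "y \<in> carrier R" "z \<in> carrier R"
      "t = el x' y' z'" "x' \<in> carrier R" "y' \<in> carrier R" "z' \<in> carrier R"
      by (auto simp: S_def)
    then show "s \<oplus> t \<in> ?S" by (simp add: el_add elI)
  qed
  moreover have "s \<otimes> t \<in> ?S" if "s \<in> ?S" "t \<in> ?S" for s t
    using that by (auto simp: S_def el_mult) (metis m_closed zero_closed)
  ultimately have sr: "nonunital_subring ?S R"
    by (simp add: nonunital_subring_def)
  show ?thesis
  proof (rule nilpotent_subring_3I[OF sr])
    fix s t u assume "s \<in> ?S" "t \<in> ?S" "u \<in> ?S"
    then show "s \<otimes> t \<otimes> u = \<zero>"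
      by (auto simp: S_def el_mult el_zero)
  next
    \<comment> \<open>the elements \<open>c1 h2\<close> and \<open>c2 h3\<close>, whose product is \<open>c1 h3\<close>\<close>
    show "el \<one> \<zero> \<zero> \<in> ?S" "el \<zero> \<zero> \<one> \<in> ?S" by (auto intro: elI)
    show "el \<one> \<zero> \<zero> \<otimes> el \<zero> \<zero> \<one> \<noteq> \<zero>"
      using nz by (simp add: el_mult) (simp add: el_def)
  qed
qed

text \<open>The relations \<open>p_q\<close> and \<open>q_p_sum\<close> say that \<open>x \<mapsto> (p i x q j)\<^sub>i\<^sub>j\<close> is an isomorphism from \<open>R\<close> onto
  the ring of \<open>3 \<times> 3\<close> matrices over \<open>R\<close> itself;
  \<open>commutator_surj\<close> says that every element is a commutator with the one fixed \<open>a\<close>. All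
  these conditions survive the passage to a nonzero quotient. The indices are integers because the simplifier would rewrite the
  natural number \<open>1\<close> to \<open>Suc 0\<close>.\<close>

locale matrix_like_ring = ring R for R (structure) +
  fixes p q :: "int \<Rightarrow> 'a" and a
  assumes closed [simp]: "p i \<in> carrier R" "q i \<in> carrier R" "a \<in> carrier R"
    and p_q: "\<lbrakk>i \<in> {1..3}; j \<in> {1..3}\<rbrakk> \<Longrightarrow> p i \<otimes> q j = (if i = j then \<one> else \<zero>)"
    and q_p_sum: "q 1 \<otimes> p 1 \<oplus> q 2 \<otimes> p 2 \<oplus> q 3 \<otimes> p 3 = \<one>"
    and commutator_surj: "d \<in> carrier R \<Longrightarrow> \<exists>w\<in>carrier R. a \<otimes> w = d \<oplus> w \<otimes> a"
    and nontrivial: "\<one> \<noteq> \<zero>"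
begin

lemma p_q_assoc:
  assumes "i \<in> {1..3}" "j \<in> {1..3}" "x \<in> carrier R"
  shows "p i \<otimes> (q j \<otimes> x) = (if i = j then x else \<zero>)"
  using p_q[of i j] assms by (simp flip: m_assoc)

text \<open>The third ring belongs to the matrix \<open>g\<close> with rows \<open>(1, 0, 0)\<close>, \<open>(1, a, 1)\<close>,
  \<open>(1, 1, 0)\<close>; the last two rows of its inverse are \<open>(-1, 0, 1)\<close> and \<open>(a - 1, 1, -a)\<close>.\<close>

definition upper where "upper = flag_subring R (q 1) (q 2) (p 2) (p 3)"
definition lower where "lower = flag_subring R (q 3) (q 2) (p 2) (p 1)"
definition slanted where "slanted = flag_subring R (q 1 \<oplus> q 2 \<oplus> q 3) (q 2 \<otimes> a \<oplus> q 3)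
  (p 3 \<oplus> \<ominus> p 1) ((a \<oplus> \<ominus> \<one>) \<otimes> p 1 \<oplus> p 2 \<oplus> \<ominus> (a \<otimes> p 3))"

lemma prod_neq_zero:
  assumes "u \<in> carrier R" "c \<in> carrier R" "h \<in> carrier R" "v \<in> carrier R"
    and "u \<otimes> c = \<one>" "h \<otimes> v = \<one>"
  shows "c \<otimes> h \<noteq> \<zero>"
proof
  assume "c \<otimes> h = \<zero>"
  then have "u \<otimes> (c \<otimes> h) \<otimes> v = \<zero>" using assms by simp
  moreover have "u \<otimes> (c \<otimes> h) \<otimes> v = (u \<otimes> c) \<otimes> (h \<otimes> v)" using assms(1-4) by (simp add: m_assoc)
  ultimately show False using assms nontrivial by simp
qed

lemma upper_nilpotent: "nilpotent_subring upper 3 R"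
  unfolding upper_def
proof (rule flag_subring_nilpotent)
  show "q 1 \<otimes> p 3 \<noteq> \<zero>" by (rule prod_neq_zero[of "p 1" _ _ "q 3"]) (simp_all add: p_q)
qed (simp_all add: p_q)

lemma lower_nilpotent: "nilpotent_subring lower 3 R"
  unfolding lower_def
proof (rule flag_subring_nilpotent)
  show "q 3 \<otimes> p 1 \<noteq> \<zero>" by (rule prod_neq_zero[of "p 3" _ _ "q 1"]) (simp_all add: p_q)
qed (simp_all add: p_q)

lemma slanted_nilpotent: "nilpotent_subring slanted 3 R"
  unfolding slanted_def
proof (rule flag_subring_nilpotent)
  let ?c1 = "q 1 \<oplus> q 2 \<oplus> q 3" and ?h3 = "(a \<oplus> \<ominus> \<one>) \<otimes> p 1 \<oplus> p 2 \<oplus> \<ominus> (a \<otimes> p 3)"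
  have "p 2 \<otimes> ?c1 = \<one>" "?h3 \<otimes> q 2 = \<one>"
    by (simp_all add: l_distr r_distr l_minus m_assoc p_q)
  then show "?c1 \<otimes> ?h3 \<noteq> \<zero>" by (intro prod_neq_zero[of "p 2" _ _ "q 2"]) simp_all
  show "?h3 \<otimes> ?c1 = \<zero>"
    by (simp add: l_distr r_distr l_minus m_assoc p_q a_ac l_neg r_neg r_neg1 r_neg2)
qed (simp_all add: l_distr r_distr l_minus r_minus m_assoc p_q p_q_assoc l_neg r_neg)

text \<open>With coordinates \<open>x, y, z\<close> the diagonal of an element of the slanted ring is
  \<open>(- x + y (a - 1), y + a z, x - y a - z a)\<close>, with sum \<open>a z - z a\<close>. A commutator can be
  any element, so the trace does not restrict the diagonal: \<open>z\<close> is chosen to match the sum,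
  and then \<open>y\<close> and \<open>x\<close> to match the first two entries.\<close>

lemma slanted_diagonal:
  assumes d: "d1 \<in> carrier R" "d2 \<in> carrier R" "d3 \<in> carrier R"
  shows "\<exists>s\<in>slanted. p 1 \<otimes> s \<otimes> q 1 = d1 \<and> p 2 \<otimes> s \<otimes> q 2 = d2 \<and> p 3 \<otimes> s \<otimes> q 3 = d3"
proof -
  let ?c1 = "q 1 \<oplus> q 2 \<oplus> q 3" and ?c2 = "q 2 \<otimes> a \<oplus> q 3"
    and ?h2 = "p 3 \<oplus> \<ominus> p 1" and ?h3 = "(a \<oplus> \<ominus> \<one>) \<otimes> p 1 \<oplus> p 2 \<oplus> \<ominus> (a \<otimes> p 3)"
  obtain z where z: "z \<in> carrier R" and az: "a \<otimes> z = (d1 \<oplus> d2 \<oplus> d3) \<oplus> z \<otimes> a"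
    using commutator_surj[of "d1 \<oplus> d2 \<oplus> d3"] d by auto
  define y where "y = d2 \<oplus> \<ominus> (a \<otimes> z)"
  define x where "x = y \<otimes> (a \<oplus> \<ominus> \<one>) \<oplus> \<ominus> d1"
  have xyz [simp]: "x \<in> carrier R" "y \<in> carrier R" "z \<in> carrier R" using d by (simp_all add: x_def y_def z)
  define s where "s = ?c1 \<otimes> x \<otimes> ?h2 \<oplus> ?c1 \<otimes> y \<otimes> ?h3 \<oplus> ?c2 \<otimes> z \<otimes> ?h3"
  have pc: "p 1 \<otimes> ?c1 = \<one>" "p 2 \<otimes> ?c1 = \<one>" "p 3 \<otimes> ?c1 = \<one>"
    "p 1 \<otimes> ?c2 = \<zero>" "p 2 \<otimes> ?c2 = a" "p 3 \<otimes> ?c2 = \<one>"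
    by (simp_all add: r_distr p_q p_q_assoc)
  have hq: "?h2 \<otimes> q 1 = \<ominus> \<one>" "?h2 \<otimes> q 2 = \<zero>" "?h2 \<otimes> q 3 = \<one>"
    "?h3 \<otimes> q 1 = a \<oplus> \<ominus> \<one>" "?h3 \<otimes> q 2 = \<one>" "?h3 \<otimes> q 3 = \<ominus> a"
    by (simp_all add: l_distr l_minus m_assoc p_q)
  have entry: "p i \<otimes> s \<otimes> q j = (p i \<otimes> ?c1) \<otimes> x \<otimes> (?h2 \<otimes> q j) \<oplus> (p i \<otimes> ?c1) \<otimes> y \<otimes> (?h3 \<otimes> q j)
      \<oplus> (p i \<otimes> ?c2) \<otimes> z \<otimes> (?h3 \<otimes> q j)" for i j
  proof -
    have gen: "P \<otimes> (C1 \<otimes> x \<otimes> H2 \<oplus> C1 \<otimes> y \<otimes> H3 \<oplus> C2 \<otimes> z \<otimes> H3) \<otimes> T =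
      (P \<otimes> C1) \<otimes> x \<otimes> (H2 \<otimes> T) \<oplus> (P \<otimes> C1) \<otimes> y \<otimes> (H3 \<otimes> T) \<oplus> (P \<otimes> C2) \<otimes> z \<otimes> (H3 \<otimes> T)"
      if "P \<in> carrier R" "T \<in> carrier R" "C1 \<in> carrier R" "C2 \<in> carrier R" "H2 \<in> carrier R" "H3 \<in> carrier R"
      for P T C1 C2 H2 H3
      using that by (simp add: l_distr r_distr m_assoc)
    show ?thesis unfolding s_def by (rule gen) simp_all
  qed
  have "s \<in> slanted"
    unfolding slanted_def flag_subring_def s_def using xyz by blast
  moreover have "p 1 \<otimes> s \<otimes> q 1 = d1"
  proof -
    have "p 1 \<otimes> s \<otimes> q 1 = \<ominus> x \<oplus> y \<otimes> (a \<oplus> \<ominus> \<one>)"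
      unfolding entry pc hq by (simp add: r_minus)
    also have "y \<otimes> (a \<oplus> \<ominus> \<one>) = x \<oplus> d1"
      unfolding x_def using d by (simp add: a_assoc l_neg)
    finally show ?thesis using d by (simp add: r_neg1)
  qed
  moreover have "p 2 \<otimes> s \<otimes> q 2 = d2"
    unfolding entry pc hq using d by (simp add: y_def a_assoc l_neg)
  moreover have "p 3 \<otimes> s \<otimes> q 3 = d3"
  proof -
    have "p 3 \<otimes> s \<otimes> q 3 = x \<oplus> \<ominus> (y \<otimes> a) \<oplus> \<ominus> (z \<otimes> a)"
      unfolding entry pc hq by (simp add: r_minus)
    also have "x = (y \<otimes> a \<oplus> \<ominus> y) \<oplus> \<ominus> d1"
      using d by (simp add: x_def r_distr r_minus)
    also have "\<ominus> y = (d1 \<oplus> d2 \<oplus> d3) \<oplus> z \<otimes> a \<oplus> \<ominus> d2"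
      using d by (simp add: y_def minus_add az a_ac)
    finally show ?thesis
      using d by (simp add: a_ac cancel_skip r_neg r_neg1 r_neg2 l_neg)
  qed
  ultimately show ?thesis by blast
qed

text \<open>Expand \<open>x = 1 x 1\<close> with \<open>1 = q 1 p 1 + q 2 p 2 + q 3 p 3\<close> on both sides; the three diagonal
  terms of the nine vanish.\<close>

lemma zero_diagonal_decomp:
  assumes x: "x \<in> carrier R"
    and diag: "p 1 \<otimes> x \<otimes> q 1 = \<zero>" "p 2 \<otimes> x \<otimes> q 2 = \<zero>" "p 3 \<otimes> x \<otimes> q 3 = \<zero>"
  shows "\<exists>u\<in>upper. \<exists>l\<in>lower. x = u \<oplus> l"
proof -
  define e where "e i j = p i \<otimes> x \<otimes> q j" for i j
  have e [simp]: "e i j \<in> carrier R" for i j using x by (simp add: e_def)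
  have q_e_p: "q i \<otimes> e i j \<otimes> p j = (q i \<otimes> p i) \<otimes> x \<otimes> (q j \<otimes> p j)" for i j
    using x by (simp add: e_def m_assoc)
  let ?D = "\<lambda>i. q i \<otimes> p i"
  define u where "u = q 1 \<otimes> e 1 2 \<otimes> p 2 \<oplus> q 1 \<otimes> e 1 3 \<otimes> p 3 \<oplus> q 2 \<otimes> e 2 3 \<otimes> p 3"
  define l where "l = q 3 \<otimes> e 3 2 \<otimes> p 2 \<oplus> q 3 \<otimes> e 3 1 \<otimes> p 1 \<oplus> q 2 \<otimes> e 2 1 \<otimes> p 1"
  have ul: "u \<in> upper" "l \<in> lower"
    unfolding upper_def lower_def flag_subring_def u_def l_def using e by blast+
  have "?D 1 \<otimes> x \<otimes> ?D 1 = \<zero>" "?D 2 \<otimes> x \<otimes> ?D 2 = \<zero>" "?D 3 \<otimes> x \<otimes> ?D 3 = \<zero>"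
    unfolding q_e_p[symmetric] by (simp_all add: e_def diag)
  moreover have "x = (?D 1 \<oplus> ?D 2 \<oplus> ?D 3) \<otimes> x \<otimes> (?D 1 \<oplus> ?D 2 \<oplus> ?D 3)"
    using x by (simp add: q_p_sum)
  moreover have "(D1 \<oplus> D2 \<oplus> D3) \<otimes> x \<otimes> (D1 \<oplus> D2 \<oplus> D3) =
      (D1 \<otimes> x \<otimes> D1 \<oplus> D2 \<otimes> x \<otimes> D2 \<oplus> D3 \<otimes> x \<otimes> D3)
      \<oplus> ((D1 \<otimes> x \<otimes> D2 \<oplus> D1 \<otimes> x \<otimes> D3 \<oplus> D2 \<otimes> x \<otimes> D3)
       \<oplus> (D3 \<otimes> x \<otimes> D2 \<oplus> D3 \<otimes> x \<otimes> D1 \<oplus> D2 \<otimes> x \<otimes> D1))"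
    if "D1 \<in> carrier R" "D2 \<in> carrier R" "D3 \<in> carrier R" for D1 D2 D3
    using x that by (simp add: l_distr r_distr a_ac)
  ultimately have "x = u \<oplus> l"
    unfolding u_def l_def q_e_p using x by simp
  with ul show ?thesis by blast
qed

text \<open>The slanted ring takes care of the diagonal of a given element; a matrix with zero
  diagonal is the sum of a strictly upper and a strictly lower triangular one.\<close>

lemma sum_of_three_nilpotent_subrings: "sum_of_three_nilpotent_subrings 3 R"
  unfolding sum_of_three_nilpotent_subrings_def
proof (intro exI conjI)
  have sub: "S \<subseteq> carrier R" if "nilpotent_subring S 3 R" for S
    using that subgroup.subset[of S "add_monoid R"]
    by (auto simp: nilpotent_subring_def nonunital_subring_def)
  note sub = sub[OF upper_nilpotent] sub[OF lower_nilpotent] sub[OF slanted_nilpotent]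
  show "carrier R = upper <+>\<^bsub>R\<^esub> lower <+>\<^bsub>R\<^esub> slanted"
  proof (intro equalityI subsetI)
    fix x assume x: "x \<in> carrier R"
    obtain s where s: "s \<in> slanted" and diag: "p 1 \<otimes> s \<otimes> q 1 = p 1 \<otimes> x \<otimes> q 1"
      "p 2 \<otimes> s \<otimes> q 2 = p 2 \<otimes> x \<otimes> q 2" "p 3 \<otimes> s \<otimes> q 3 = p 3 \<otimes> x \<otimes> q 3"
      using slanted_diagonal[of "p 1 \<otimes> x \<otimes> q 1" "p 2 \<otimes> x \<otimes> q 2" "p 3 \<otimes> x \<otimes> q 3"] x by auto
    have [simp]: "s \<in> carrier R" using s sub by blast
    have "p i \<otimes> (x \<oplus> \<ominus> s) \<otimes> q i = p i \<otimes> x \<otimes> q i \<oplus> \<ominus> (p i \<otimes> s \<otimes> q i)" for i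
      using x by (simp add: l_distr r_distr l_minus r_minus)
    then have "\<exists>u\<in>upper. \<exists>l\<in>lower. x \<oplus> \<ominus> s = u \<oplus> l"
      using x by (intro zero_diagonal_decomp) (simp_all add: diag r_neg)
    then obtain u l where ul: "u \<in> upper" "l \<in> lower" "x \<oplus> \<ominus> s = u \<oplus> l" by blast
    then have "x = u \<oplus> l \<oplus> s"
      using x by (metis \<open>s \<in> carrier R\<close> a_assoc a_inv_closed l_neg r_zero)
    with ul s show "x \<in> upper <+>\<^bsub>R\<^esub> lower <+>\<^bsub>R\<^esub> slanted"
      by (auto simp: set_add_def')
  next
    fix x assume "x \<in> upper <+>\<^bsub>R\<^esub> lower <+>\<^bsub>R\<^esub> slanted"
    with sub show "x \<in> carrier R"
      by (auto simp: set_add_def' intro!: a_closed)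
  qed
qed (fact upper_nilpotent lower_nilpotent slanted_nilpotent)+

end

section \<open>Braceable subtrusses from nilpotent subrings\<close>

lemma (in ring) ring_truss_is_truss:
  "is_truss (ring_truss R)"
proof -
  have "\<exists>G :: 'a monoid. comm_group G \<and> carrier G = carrier R \<and>
      (\<forall>x\<in>carrier R. \<forall>y\<in>carrier R. \<forall>z\<in>carrier R. x \<ominus> y \<oplus> z = x \<otimes>\<^bsub>G\<^esub> inv\<^bsub>G\<^esub> y \<otimes>\<^bsub>G\<^esub> z)"
  proof (intro exI conjI)
    let ?G = "\<lparr>carrier = carrier R, mult = (\<oplus>), one = \<zero>\<rparr>"
    show "comm_group ?G"
      by (rule comm_groupI) (auto simp: a_ac intro!: bexI[of _ "\<ominus> _"] l_neg)
    show "\<forall>x\<in>carrier R. \<forall>y\<in>carrier R. \<forall>z\<in>carrier R. x \<ominus> y \<oplus> z = x \<otimes>\<^bsub>?G\<^esub> inv\<^bsub>?G\<^esub> y \<otimes>\<^bsub>?G\<^esub> z"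
      by (simp add: minus_eq a_inv_def m_inv_def)
  qed simp
  then show ?thesis
    by (simp add: is_truss_def ring_truss_def) (simp add: minus_eq m_assoc l_distr r_distr l_minus r_minus)
qed

text \<open>The set \<open>1 + S\<close> is a group under multiplication because \<open>1 - s + s\<^sup>2\<close> inverts
  \<open>1 + s\<close> when \<open>s\<^sup>3 = 0\<close>. It is a coset, and the heap operation on a coset is that of the
  abelian group whose neutral element is any chosen point of it, here \<open>1\<close>.\<close>

lemma (in ring) braceable_subtruss_one_plus:
  assumes S: "nilpotent_subring S 3 R"
  shows "braceable_subtruss {\<one> \<oplus> s | s. s \<in> S} (ring_truss R)"
proof -
  let ?K = "{\<one> \<oplus> s | s. s \<in> S}" and ?T = "ring_truss R"
  have sg: "subgroup S (add_monoid R)" and mult [simp]: "\<And>x y. x \<in> S \<Longrightarrow> y \<in> S \<Longrightarrow> x \<otimes> y \<in> S"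
    and pow: "ideal_prod R (ideal_prod R S S) S = {\<zero>}"
    using S by (auto simp: nilpotent_subring_def nonunital_subring_def numeral_3_eq_3)
  have carr [simp]: "x \<in> carrier R" if "x \<in> S" for x
    using subgroup.subset[OF sg] that by auto
  have zero [simp]: "\<zero> \<in> S" using subgroup.one_closed[OF sg] by simp
  have add [simp]: "x \<oplus> y \<in> S" if "x \<in> S" "y \<in> S" for x y
    using subgroup.m_closed[OF sg that] by simp
  have neg [simp]: "\<ominus> x \<in> S" if "x \<in> S" for x
    using subgroup.m_inv_closed[OF sg that] by (simp add: a_inv_def)
  have cube: "x \<otimes> x \<otimes> x = \<zero>" if "x \<in> S" for x
  proof -
    have "x \<otimes> x \<otimes> x \<in> ideal_prod R (ideal_prod R S S) S"
      using that by (intro ideal_prod.prod)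
    then show ?thesis using pow by simp
  qed
  have K_sub: "?K \<subseteq> carrier R" by auto
  have K_heap: "x \<ominus> y \<oplus> z \<in> ?K" if xyz: "x \<in> ?K" "y \<in> ?K" "z \<in> ?K" for x y z
  proof -
    obtain s t u where st: "x = \<one> \<oplus> s" "y = \<one> \<oplus> t" "z = \<one> \<oplus> u" "s \<in> S" "t \<in> S" "u \<in> S"
      using xyz by blast
    then have "x \<ominus> y \<oplus> z = \<one> \<oplus> (s \<oplus> \<ominus> t \<oplus> u)"
      by (simp add: minus_eq minus_add a_ac cancel_skip r_neg r_neg1 r_neg2)
    with st show ?thesis by (intro CollectI exI[of _ "s \<oplus> \<ominus> t \<oplus> u"] conjI) simp_all
  qed
  have K_mult: "x \<otimes> y \<in> ?K" if xy: "x \<in> ?K" "y \<in> ?K" for x y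
  proof -
    obtain s t where st: "x = \<one> \<oplus> s" "y = \<one> \<oplus> t" "s \<in> S" "t \<in> S"
      using xy by blast
    then have "x \<otimes> y = \<one> \<oplus> (s \<oplus> t \<oplus> s \<otimes> t)"
      by (simp add: l_distr r_distr a_ac)
    with st show ?thesis by (intro CollectI exI[of _ "s \<oplus> t \<oplus> s \<otimes> t"] conjI) simp_all
  qed
  have K_one: "\<one> \<in> ?K"
    by (intro CollectI exI[of _ \<zero>]) simp
  have K_inv: "\<exists>y\<in>?K. y \<otimes> x = \<one>" if x: "x \<in> ?K" for x
  proof -
    obtain s where s: "x = \<one> \<oplus> s" "s \<in> S" using x by auto
    have "(\<one> \<oplus> (\<ominus> s \<oplus> s \<otimes> s)) \<otimes> x = \<one>"
      using s cube[of s] by (simp add: l_distr r_distr l_minus a_ac r_neg r_neg1 r_neg2 l_neg)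
    with s show ?thesis by (intro bexI[of _ "\<one> \<oplus> (\<ominus> s \<oplus> s \<otimes> s)"]) auto
  qed
  have comm: "comm_group \<lparr>carrier = ?K, mult = (\<lambda>x y. x \<ominus> \<one> \<oplus> y), one = \<one>\<rparr>" (is "comm_group ?G")
  proof (rule comm_groupI)
    fix x assume x: "x \<in> carrier ?G"
    then have "\<one> \<ominus> x \<oplus> \<one> \<in> ?K" using K_heap K_one by simp
    moreover have "(\<one> \<ominus> x \<oplus> \<one>) \<otimes>\<^bsub>?G\<^esub> x = \<one>"
      using x K_sub by (auto simp: minus_eq a_ac r_neg r_neg1 r_neg2 l_neg minus_add)
    ultimately show "\<exists>y\<in>carrier ?G. y \<otimes>\<^bsub>?G\<^esub> x = \<one>\<^bsub>?G\<^esub>" by auto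
  qed (use K_sub K_one K_heap in \<open>auto simp: minus_eq a_ac r_neg r_neg1 r_neg2 l_neg\<close>)
  interpret G: comm_group ?G by (fact comm)
  have G_inv: "inv\<^bsub>?G\<^esub> y = \<one> \<ominus> y \<oplus> \<one>" if y: "y \<in> ?K" for y
  proof (rule G.inv_equality)
    show "(\<one> \<ominus> y \<oplus> \<one>) \<otimes>\<^bsub>?G\<^esub> y = \<one>\<^bsub>?G\<^esub>"
      using y K_sub by (auto simp: minus_eq a_ac r_neg r_neg1 r_neg2 l_neg minus_add)
    show "y \<in> carrier ?G" "\<one> \<ominus> y \<oplus> \<one> \<in> carrier ?G"
      using y K_heap[OF K_one y K_one] by simp_all
  qed
  have "x \<ominus> y \<oplus> z = x \<otimes>\<^bsub>?G\<^esub> inv\<^bsub>?G\<^esub> y \<otimes>\<^bsub>?G\<^esub> z"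
    if "x \<in> ?K" "y \<in> ?K" "z \<in> ?K" for x y z
  proof -
    have "x \<in> carrier R" "y \<in> carrier R" "z \<in> carrier R" using that K_sub by blast+
    then show ?thesis
      unfolding G_inv[OF that(2)] by (simp add: minus_eq a_ac cancel_skip r_neg r_neg1 r_neg2 l_neg)
  qed
  with comm have heap: "\<exists>G :: 'a monoid. comm_group G \<and> carrier G = ?K \<and>
      (\<forall>x\<in>?K. \<forall>y\<in>?K. \<forall>z\<in>?K. x \<ominus> y \<oplus> z = x \<otimes>\<^bsub>G\<^esub> inv\<^bsub>G\<^esub> y \<otimes>\<^bsub>G\<^esub> z)"
    by (intro exI[of _ ?G]) simp
  have "is_truss (?T\<lparr>carrier := ?K\<rparr>)"
    unfolding is_truss_def
  proof (intro conjI)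
    show "\<exists>G :: 'a monoid. comm_group G \<and> carrier G = carrier (?T\<lparr>carrier := ?K\<rparr>) \<and>
      (\<forall>x\<in>carrier (?T\<lparr>carrier := ?K\<rparr>). \<forall>y\<in>carrier (?T\<lparr>carrier := ?K\<rparr>). \<forall>z\<in>carrier (?T\<lparr>carrier := ?K\<rparr>).
        heap (?T\<lparr>carrier := ?K\<rparr>) x y z = x \<otimes>\<^bsub>G\<^esub> inv\<^bsub>G\<^esub> y \<otimes>\<^bsub>G\<^esub> z)"
      using heap by (simp add: ring_truss_def)
  next
    show "\<forall>x\<in>carrier (?T\<lparr>carrier := ?K\<rparr>). \<forall>y\<in>carrier (?T\<lparr>carrier := ?K\<rparr>).
        tmult (?T\<lparr>carrier := ?K\<rparr>) x y \<in> carrier (?T\<lparr>carrier := ?K\<rparr>)"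
      using K_mult by (simp add: ring_truss_def)
  qed (use ring_truss_is_truss K_sub in \<open>simp_all add: is_truss_def ring_truss_def subset_iff\<close>)
  moreover have "group \<lparr>carrier = ?K, mult = (\<otimes>), one = \<one>\<rparr>"
    using K_sub K_one K_mult K_inv by (intro groupI) (auto simp: m_assoc)
  ultimately show ?thesis
    using ring_truss_is_truss K_sub K_heap K_mult
    unfolding braceable_subtruss_def subtruss_def braceable_def
    by (auto simp: ring_truss_def)
qed

text \<open>This rests on the identity \<open>(1 + s) - (1 - t) + (1 + u) = 1 + (s + t + u)\<close>.\<close>

lemma (in ring) sum_of_three_braceable_subtrusses:
  assumes "sum_of_three_nilpotent_subrings 3 R"
  shows "\<exists>K L M. braceable_subtruss K (ring_truss R) \<and> braceable_subtruss L (ring_truss R) \<and>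
    braceable_subtruss M (ring_truss R) \<and> carrier R = heap_set (ring_truss R) K L M"
proof -
  obtain S1 S2 S3 where nil: "nilpotent_subring S1 3 R" "nilpotent_subring S2 3 R" "nilpotent_subring S3 3 R"
    and sum: "carrier R = S1 <+>\<^bsub>R\<^esub> S2 <+>\<^bsub>R\<^esub> S3"
    using assms unfolding sum_of_three_nilpotent_subrings_def by blast
  have sg: "subgroup S1 (add_monoid R)" "subgroup S2 (add_monoid R)" "subgroup S3 (add_monoid R)"
    using nil by (simp_all add: nilpotent_subring_def nonunital_subring_def)
  have sub: "S1 \<subseteq> carrier R" "S2 \<subseteq> carrier R" "S3 \<subseteq> carrier R"
    using sg[THEN subgroup.subset] by simp_all
  have neg: "\<ominus> s \<in> S2" if "s \<in> S2" for s
    using subgroup.m_inv_closed[OF sg(2) that] by (simp add: a_inv_def)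
  let ?K = "\<lambda>S. {\<one> \<oplus> s | s. s \<in> S}"
  have "carrier R = heap_set (ring_truss R) (?K S1) (?K S2) (?K S3)"
  proof (intro equalityI subsetI)
    fix x assume x: "x \<in> carrier R"
    then have "x \<oplus> \<ominus> \<one> \<in> S1 <+>\<^bsub>R\<^esub> S2 <+>\<^bsub>R\<^esub> S3" unfolding sum[symmetric] by simp
    then obtain s t u where stu: "s \<in> S1" "t \<in> S2" "u \<in> S3" "x \<oplus> \<ominus> \<one> = s \<oplus> t \<oplus> u"
      by (auto simp: set_add_def')
    have [simp]: "s \<in> carrier R" "t \<in> carrier R" "u \<in> carrier R" using stu sub by blast+
    have "(\<one> \<oplus> s) \<ominus> (\<one> \<oplus> \<ominus> t) \<oplus> (\<one> \<oplus> u) = \<one> \<oplus> (s \<oplus> t \<oplus> u)"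
      by (simp add: minus_eq minus_add a_ac cancel_skip r_neg r_neg1 r_neg2)
    also have "\<dots> = x"
      unfolding stu(4)[symmetric] using x by (simp add: a_ac r_neg r_neg1 r_neg2 cancel_skip)
    finally show "x \<in> heap_set (ring_truss R) (?K S1) (?K S2) (?K S3)"
      using stu neg by (auto simp: heap_set_def ring_truss_def intro!: exI)
  next
    fix x assume "x \<in> heap_set (ring_truss R) (?K S1) (?K S2) (?K S3)"
    then show "x \<in> carrier R"
      using sub by (auto simp: heap_set_def ring_truss_def subset_iff)
  qed
  then show ?thesis using nil[THEN braceable_subtruss_one_plus] by blast
qed

section \<open>Endomorphism rings of modules\<close>

lemma finite_ordLess_infinite_set: "finite A \<Longrightarrow> infinite B \<Longrightarrow> |A| <o |B|"
  by (rule finite_ordLess_infinite[OF card_of_Well_order card_of_Well_order]) (simp_all add: Field_card_of)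

context left_module begin

lemma smult_l_null [simp]: "x \<in> carrier M \<Longrightarrow> \<zero> \<odot>\<^bsub>M\<^esub> x = \<zero>\<^bsub>M\<^esub>"
  using smult_l_distr[of \<zero> \<zero> x] by (simp add: M.add.l_cancel_one')

lemma smult_r_null [simp]: "c \<in> carrier R \<Longrightarrow> c \<odot>\<^bsub>M\<^esub> \<zero>\<^bsub>M\<^esub> = \<zero>\<^bsub>M\<^esub>"
  using smult_r_distr[of c "\<zero>\<^bsub>M\<^esub>" "\<zero>\<^bsub>M\<^esub>"] by (simp add: M.add.l_cancel_one')

lemma smult_l_minus: "c \<in> carrier R \<Longrightarrow> x \<in> carrier M \<Longrightarrow> (\<ominus> c) \<odot>\<^bsub>M\<^esub> x = \<ominus>\<^bsub>M\<^esub> (c \<odot>\<^bsub>M\<^esub> x)"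
  using smult_l_distr[of "\<ominus> c" c x] by (simp add: R.l_neg M.minus_equality)

lemma smult_r_minus: "c \<in> carrier R \<Longrightarrow> x \<in> carrier M \<Longrightarrow> c \<odot>\<^bsub>M\<^esub> (\<ominus>\<^bsub>M\<^esub> x) = \<ominus>\<^bsub>M\<^esub> (c \<odot>\<^bsub>M\<^esub> x)"
  using smult_r_distr[of c "\<ominus>\<^bsub>M\<^esub> x" x] by (simp add: M.l_neg M.minus_equality)

lemma smult_finsum:
  assumes "finite A" "c \<in> carrier R" "\<And>b. b \<in> A \<Longrightarrow> f b \<in> carrier M"
  shows "c \<odot>\<^bsub>M\<^esub> finsum M f A = finsum M (\<lambda>b. c \<odot>\<^bsub>M\<^esub> f b) A"
  using assms
proof (induction A rule: finite_induct)
  case (insert b A)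
  then have "f \<in> A \<rightarrow> carrier M" "f b \<in> carrier M" by auto
  with insert show ?case by (simp add: smult_r_distr Pi_iff)
qed simp

lemma finsum_subset_zero:
  assumes "finite C" "A \<subseteq> C" "\<And>b. b \<in> C \<Longrightarrow> f b \<in> carrier M" "\<And>b. b \<in> C \<Longrightarrow> b \<notin> A \<Longrightarrow> f b = \<zero>\<^bsub>M\<^esub>"
  shows "finsum M f A = finsum M f C"
  using assms by (intro M.add.finprod_mono_neutral_cong_left) auto

abbreviation E where "E \<equiv> End_ring R M"

lemma endo_iff:
  "f \<in> carrier E \<longleftrightarrow> f \<in> extensional (carrier M) \<and> (\<forall>x\<in>carrier M. f x \<in> carrier M) \<and>
     (\<forall>x\<in>carrier M. \<forall>y\<in>carrier M. f (x \<oplus>\<^bsub>M\<^esub> y) = f x \<oplus>\<^bsub>M\<^esub> f y) \<and>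
     (\<forall>c\<in>carrier R. \<forall>x\<in>carrier M. f (c \<odot>\<^bsub>M\<^esub> x) = c \<odot>\<^bsub>M\<^esub> f x)"
  by (auto simp: End_ring_def module_endos_def hom_def)

lemma endoI:
  assumes "f \<in> extensional (carrier M)" "\<And>x. x \<in> carrier M \<Longrightarrow> f x \<in> carrier M"
    and "\<And>x y. \<lbrakk>x \<in> carrier M; y \<in> carrier M\<rbrakk> \<Longrightarrow> f (x \<oplus>\<^bsub>M\<^esub> y) = f x \<oplus>\<^bsub>M\<^esub> f y"
    and "\<And>c x. \<lbrakk>c \<in> carrier R; x \<in> carrier M\<rbrakk> \<Longrightarrow> f (c \<odot>\<^bsub>M\<^esub> x) = c \<odot>\<^bsub>M\<^esub> f x"
  shows "f \<in> carrier E"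
  using assms by (simp add: endo_iff)

lemma endo_closed [simp]: "f \<in> carrier E \<Longrightarrow> x \<in> carrier M \<Longrightarrow> f x \<in> carrier M"
  and endo_add: "f \<in> carrier E \<Longrightarrow> x \<in> carrier M \<Longrightarrow> y \<in> carrier M \<Longrightarrow> f (x \<oplus>\<^bsub>M\<^esub> y) = f x \<oplus>\<^bsub>M\<^esub> f y"
  and endo_smult: "f \<in> carrier E \<Longrightarrow> c \<in> carrier R \<Longrightarrow> x \<in> carrier M \<Longrightarrow> f (c \<odot>\<^bsub>M\<^esub> x) = c \<odot>\<^bsub>M\<^esub> f x"
  by (auto simp: endo_iff)

lemma endo_zero: "f \<in> carrier E \<Longrightarrow> f \<zero>\<^bsub>M\<^esub> = \<zero>\<^bsub>M\<^esub>"
  using endo_smult[of f \<zero> "\<zero>\<^bsub>M\<^esub>"] by simp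

lemma endo_finsum:
  assumes "f \<in> carrier E" "finite A" "\<And>b. b \<in> A \<Longrightarrow> g b \<in> carrier M"
  shows "f (finsum M g A) = finsum M (\<lambda>b. f (g b)) A"
  using assms(2,3)
proof (induction A rule: finite_induct)
  case (insert b A)
  then have "g \<in> A \<rightarrow> carrier M" "g b \<in> carrier M" by auto
  with insert assms(1) show ?case by (simp add: endo_add Pi_iff)
qed (simp add: endo_zero assms)

lemma endo_eqI:
  assumes "f \<in> carrier E" "g \<in> carrier E" "\<And>x. x \<in> carrier M \<Longrightarrow> f x = g x"
  shows "f = g"
  using assms by (auto simp: endo_iff intro: extensionalityI)

lemma E_mult_apply [simp]: "x \<in> carrier M \<Longrightarrow> (f \<otimes>\<^bsub>E\<^esub> g) x = f (g x)"
  and E_add_apply [simp]: "x \<in> carrier M \<Longrightarrow> (f \<oplus>\<^bsub>E\<^esub> g) x = f x \<oplus>\<^bsub>M\<^esub> g x"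
  and E_one_apply [simp]: "x \<in> carrier M \<Longrightarrow> \<one>\<^bsub>E\<^esub> x = x"
  and E_zero_apply [simp]: "x \<in> carrier M \<Longrightarrow> \<zero>\<^bsub>E\<^esub> x = \<zero>\<^bsub>M\<^esub>"
  by (simp_all add: End_ring_def compose_eq)

lemma E_extensional: "f \<otimes>\<^bsub>E\<^esub> g \<in> extensional (carrier M)" "f \<oplus>\<^bsub>E\<^esub> g \<in> extensional (carrier M)"
    "\<one>\<^bsub>E\<^esub> \<in> extensional (carrier M)" "\<zero>\<^bsub>E\<^esub> \<in> extensional (carrier M)"
  by (simp_all add: End_ring_def)

lemma E_ring: "ring E"
proof -
  have mult: "f \<otimes>\<^bsub>E\<^esub> g \<in> carrier E" if "f \<in> carrier E" "g \<in> carrier E" for f g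
    using that by (intro endoI) (simp_all add: E_extensional endo_add endo_smult)
  have add: "f \<oplus>\<^bsub>E\<^esub> g \<in> carrier E" if "f \<in> carrier E" "g \<in> carrier E" for f g
    using that by (intro endoI) (simp_all add: E_extensional endo_add endo_smult smult_r_distr M.a_ac)
  have one: "\<one>\<^bsub>E\<^esub> \<in> carrier E" and zero: "\<zero>\<^bsub>E\<^esub> \<in> carrier E"
    by (rule endoI; simp add: E_extensional)+
  have neg: "\<exists>g\<in>carrier E. g \<oplus>\<^bsub>E\<^esub> f = \<zero>\<^bsub>E\<^esub>" if f: "f \<in> carrier E" for f
  proof
    show g: "(\<lambda>x\<in>carrier M. \<ominus>\<^bsub>M\<^esub> f x) \<in> carrier E"
      using f by (intro endoI) (simp_all add: endo_add endo_smult smult_r_minus M.minus_add)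
    show "(\<lambda>x\<in>carrier M. \<ominus>\<^bsub>M\<^esub> f x) \<oplus>\<^bsub>E\<^esub> f = \<zero>\<^bsub>E\<^esub>"
      using f by (intro endo_eqI[OF add[OF g f] zero]) (simp add: M.l_neg)
  qed
  show ?thesis
  proof (rule ringI)
    show "abelian_group E"
    proof (rule abelian_groupI)
      fix f g h assume "f \<in> carrier E" "g \<in> carrier E" "h \<in> carrier E"
      then show "f \<oplus>\<^bsub>E\<^esub> g \<oplus>\<^bsub>E\<^esub> h = f \<oplus>\<^bsub>E\<^esub> (g \<oplus>\<^bsub>E\<^esub> h)"
        by (intro endo_eqI add) (simp_all add: M.a_assoc)
    next
      fix f g assume "f \<in> carrier E" "g \<in> carrier E"
      then show "f \<oplus>\<^bsub>E\<^esub> g = g \<oplus>\<^bsub>E\<^esub> f"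
        by (intro endo_eqI add) (simp_all add: M.a_comm)
    next
      fix f assume "f \<in> carrier E"
      then show "\<zero>\<^bsub>E\<^esub> \<oplus>\<^bsub>E\<^esub> f = f"
        by (intro endo_eqI add zero) simp_all
    qed (use add zero neg in auto)
    show "Group.monoid E"
    proof (rule monoidI)
      fix f g h assume "f \<in> carrier E" "g \<in> carrier E" "h \<in> carrier E"
      then show "f \<otimes>\<^bsub>E\<^esub> g \<otimes>\<^bsub>E\<^esub> h = f \<otimes>\<^bsub>E\<^esub> (g \<otimes>\<^bsub>E\<^esub> h)"
        by (intro endo_eqI mult) simp_all
    next
      fix f assume "f \<in> carrier E"
      then show "\<one>\<^bsub>E\<^esub> \<otimes>\<^bsub>E\<^esub> f = f" "f \<otimes>\<^bsub>E\<^esub> \<one>\<^bsub>E\<^esub> = f"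
        by (intro endo_eqI mult one; simp)+
    qed (use mult one in auto)
    fix f g h assume "f \<in> carrier E" "g \<in> carrier E" "h \<in> carrier E"
    then show "(f \<oplus>\<^bsub>E\<^esub> g) \<otimes>\<^bsub>E\<^esub> h = f \<otimes>\<^bsub>E\<^esub> h \<oplus>\<^bsub>E\<^esub> g \<otimes>\<^bsub>E\<^esub> h"
      "h \<otimes>\<^bsub>E\<^esub> (f \<oplus>\<^bsub>E\<^esub> g) = h \<otimes>\<^bsub>E\<^esub> f \<oplus>\<^bsub>E\<^esub> h \<otimes>\<^bsub>E\<^esub> g"
      by (intro endo_eqI add mult; simp add: endo_add)+
  qed
qed

end

section \<open>Modules with a basis\<close>

locale based_module = left_module R M for R (structure) and M (structure) +
  fixes B
  assumes basis: "module_basis R M B"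
begin

lemma B_sub: "B \<subseteq> carrier M" and B_carrier [simp]: "b \<in> B \<Longrightarrow> b \<in> carrier M"
  using basis by (auto simp: module_basis_def)

lemma spanD: "x \<in> carrier M \<Longrightarrow> \<exists>A c. finite A \<and> A \<subseteq> B \<and> c \<in> A \<rightarrow> carrier R \<and> x = finsum M (\<lambda>b. c b \<odot>\<^bsub>M\<^esub> b) A"
  and indepD: "\<lbrakk>finite A; A \<subseteq> B; c \<in> A \<rightarrow> carrier R; finsum M (\<lambda>b. c b \<odot>\<^bsub>M\<^esub> b) A = \<zero>\<^bsub>M\<^esub>; b \<in> A\<rbrakk> \<Longrightarrow> c b = \<zero>"
  using basis unfolding module_basis_def by blast+

text \<open>The coordinates are a function on the whole type, zero off \<open>A\<close>, so that enlarging \<open>A\<close>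
  does not change them and two vectors can be compared on a common finite set.\<close>

definition coords_on :: "'c set \<Rightarrow> ('c \<Rightarrow> 'a) \<Rightarrow> 'c \<Rightarrow> bool" where
  "coords_on A c x \<longleftrightarrow> finite A \<and> A \<subseteq> B \<and> (\<forall>b. c b \<in> carrier R) \<and> (\<forall>b. b \<notin> A \<longrightarrow> c b = \<zero>) \<and>
     x = finsum M (\<lambda>b. c b \<odot>\<^bsub>M\<^esub> b) A"

lemma coords_on_mono: "coords_on A c x \<Longrightarrow> finite C \<Longrightarrow> A \<subseteq> C \<Longrightarrow> C \<subseteq> B \<Longrightarrow> coords_on C c x"
  unfolding coords_on_def by (auto intro!: finsum_subset_zero)

lemma coords_on_Un:
  assumes "coords_on A c x" "coords_on A' d y"
  shows "coords_on (A \<union> A') c x" "coords_on (A \<union> A') d y"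
  by (rule coords_on_mono[OF assms(1)] coords_on_mono[OF assms(2)]; use assms in \<open>auto simp: coords_on_def\<close>)+

lemma coords_on_ex: "x \<in> carrier M \<Longrightarrow> \<exists>A c. coords_on A c x"
proof -
  assume "x \<in> carrier M"
  then obtain A c where Ac: "finite A" "A \<subseteq> B" "c \<in> A \<rightarrow> carrier R" "x = finsum M (\<lambda>b. c b \<odot>\<^bsub>M\<^esub> b) A"
    using spanD by blast
  then have "x = finsum M (\<lambda>b. (if b \<in> A then c b else \<zero>) \<odot>\<^bsub>M\<^esub> b) A"
    by (simp, intro M.finsum_cong') (auto simp: Pi_iff subset_iff)
  with Ac have "coords_on A (\<lambda>b. if b \<in> A then c b else \<zero>) x"
    unfolding coords_on_def by auto
  then show ?thesis by blast
qed

lemma coords_on_add: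
  assumes "coords_on A c x" "coords_on A d y"
  shows "coords_on A (\<lambda>b. c b \<oplus> d b) (x \<oplus>\<^bsub>M\<^esub> y)"
proof -
  have "finsum M (\<lambda>b. c b \<odot>\<^bsub>M\<^esub> b) A \<oplus>\<^bsub>M\<^esub> finsum M (\<lambda>b. d b \<odot>\<^bsub>M\<^esub> b) A
      = finsum M (\<lambda>b. c b \<odot>\<^bsub>M\<^esub> b \<oplus>\<^bsub>M\<^esub> d b \<odot>\<^bsub>M\<^esub> b) A"
    using assms by (intro M.finsum_addf[symmetric]) (auto simp: coords_on_def)
  also have "\<dots> = finsum M (\<lambda>b. (c b \<oplus> d b) \<odot>\<^bsub>M\<^esub> b) A"
    using assms by (intro M.finsum_cong') (auto simp: coords_on_def smult_l_distr subset_iff)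
  finally show ?thesis using assms by (auto simp: coords_on_def)
qed

lemma coords_on_smult:
  assumes "coords_on A c x" "r \<in> carrier R"
  shows "coords_on A (\<lambda>b. r \<otimes> c b) (r \<odot>\<^bsub>M\<^esub> x)"
proof -
  have "r \<odot>\<^bsub>M\<^esub> finsum M (\<lambda>b. c b \<odot>\<^bsub>M\<^esub> b) A = finsum M (\<lambda>b. r \<odot>\<^bsub>M\<^esub> (c b \<odot>\<^bsub>M\<^esub> b)) A"
    using assms by (intro smult_finsum) (auto simp: coords_on_def)
  also have "\<dots> = finsum M (\<lambda>b. (r \<otimes> c b) \<odot>\<^bsub>M\<^esub> b) A"
    using assms by (intro M.finsum_cong') (auto simp: coords_on_def smult_assoc1 subset_iff)
  finally show ?thesis using assms by (auto simp: coords_on_def)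
qed

lemma coords_on_unique:
  assumes "coords_on A c x" "coords_on A' d x"
  shows "c = d"
proof -
  let ?C = "A \<union> A'"
  have x: "x \<in> carrier M" using assms(1) by (auto simp: coords_on_def intro!: M.finsum_closed)
  have c: "coords_on ?C c x" and d: "coords_on ?C d x"
    using coords_on_Un[OF assms] by simp_all
  have "coords_on ?C (\<lambda>b. c b \<oplus> \<ominus> \<one> \<otimes> d b) (x \<oplus>\<^bsub>M\<^esub> (\<ominus> \<one>) \<odot>\<^bsub>M\<^esub> x)"
    by (intro coords_on_add c coords_on_smult d) simp
  then have "coords_on ?C (\<lambda>b. c b \<oplus> \<ominus> \<one> \<otimes> d b) \<zero>\<^bsub>M\<^esub>"
    using x by (simp add: smult_l_minus M.r_neg)
  then have "c b \<oplus> \<ominus> \<one> \<otimes> d b = \<zero>" if "b \<in> ?C" for b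
    using that indepD[of ?C "\<lambda>b. c b \<oplus> \<ominus> \<one> \<otimes> d b" b] by (auto simp: coords_on_def)
  moreover have "c b \<in> carrier R" "d b \<in> carrier R" for b using c d by (auto simp: coords_on_def)
  ultimately have "c b = d b" if "b \<in> ?C" for b
    using that by (metis R.add.inv_solve_right' R.l_minus R.l_one R.l_zero R.one_closed R.zero_closed R.minus_minus R.a_inv_closed)
  moreover have "c b = d b" if "b \<notin> ?C" for b
    using that c d by (simp add: coords_on_def)
  ultimately show ?thesis by blast
qed

text \<open>By \<open>coords_on_unique\<close> the value does not depend on the finite set \<open>A\<close> on which the
  coordinates of \<open>x\<close> are taken.\<close>

definition lin_ext :: "('c \<Rightarrow> 'c) \<Rightarrow> 'c \<Rightarrow> 'c" where
  "lin_ext \<phi> = (\<lambda>x\<in>carrier M. THE y. \<exists>A c. coords_on A c x \<and> y = finsum M (\<lambda>b. c b \<odot>\<^bsub>M\<^esub> \<phi> b) A)"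

lemma lin_ext_eq:
  assumes c: "coords_on A c x" and \<phi>: "\<phi> \<in> B \<rightarrow> carrier M"
  shows "lin_ext \<phi> x = finsum M (\<lambda>b. c b \<odot>\<^bsub>M\<^esub> \<phi> b) A"
proof -
  have x: "x \<in> carrier M" using c by (auto simp: coords_on_def intro!: M.finsum_closed)
  have "finsum M (\<lambda>b. d b \<odot>\<^bsub>M\<^esub> \<phi> b) A' = finsum M (\<lambda>b. c b \<odot>\<^bsub>M\<^esub> \<phi> b) A" if d: "coords_on A' d x" for A' d
  proof -
    have c': "coords_on A' c x" using d coords_on_unique[OF d c] by simp
    have "finsum M (\<lambda>b. c b \<odot>\<^bsub>M\<^esub> \<phi> b) D = finsum M (\<lambda>b. c b \<odot>\<^bsub>M\<^esub> \<phi> b) (A \<union> A')"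
      if "coords_on D c x" "D \<subseteq> A \<union> A'" for D
      using that c c' \<phi> by (intro finsum_subset_zero) (auto simp: coords_on_def Pi_iff subset_iff)
    from this[OF c] this[OF c'] show ?thesis using coords_on_unique[OF d c] by simp
  qed
  with c have "(THE y. \<exists>A c. coords_on A c x \<and> y = finsum M (\<lambda>b. c b \<odot>\<^bsub>M\<^esub> \<phi> b) A) =
      finsum M (\<lambda>b. c b \<odot>\<^bsub>M\<^esub> \<phi> b) A"
    by (intro the_equality) blast+
  with x show ?thesis by (simp only: lin_ext_def restrict_apply if_True)
qed

lemma lin_ext_endo:
  assumes \<phi>: "\<phi> \<in> B \<rightarrow> carrier M"
  shows "lin_ext \<phi> \<in> carrier E"
proof (rule endoI)
  have sum_closed: "finsum M (\<lambda>b. c b \<odot>\<^bsub>M\<^esub> \<phi> b) A \<in> carrier M" if "coords_on A c x" for A c x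
    using that \<phi> by (intro M.finsum_closed) (auto simp: coords_on_def)
  show "lin_ext \<phi> \<in> extensional (carrier M)" by (simp add: lin_ext_def)
  show "lin_ext \<phi> x \<in> carrier M" if "x \<in> carrier M" for x
    using coords_on_ex[OF that] lin_ext_eq[OF _ \<phi>] sum_closed by metis
  show "lin_ext \<phi> (x \<oplus>\<^bsub>M\<^esub> y) = lin_ext \<phi> x \<oplus>\<^bsub>M\<^esub> lin_ext \<phi> y" if xy: "x \<in> carrier M" "y \<in> carrier M" for x y
  proof -
    obtain A c A' d where cd: "coords_on A c x" "coords_on A' d y" using xy coords_on_ex by metis
    note c = coords_on_Un(1)[OF cd] and d = coords_on_Un(2)[OF cd]
    have "finsum M (\<lambda>b. (c b \<oplus> d b) \<odot>\<^bsub>M\<^esub> \<phi> b) (A \<union> A')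
        = finsum M (\<lambda>b. c b \<odot>\<^bsub>M\<^esub> \<phi> b \<oplus>\<^bsub>M\<^esub> d b \<odot>\<^bsub>M\<^esub> \<phi> b) (A \<union> A')"
      using c d \<phi> by (intro M.finsum_cong') (auto simp: coords_on_def smult_l_distr Pi_iff subset_iff)
    also have "\<dots> = finsum M (\<lambda>b. c b \<odot>\<^bsub>M\<^esub> \<phi> b) (A \<union> A') \<oplus>\<^bsub>M\<^esub> finsum M (\<lambda>b. d b \<odot>\<^bsub>M\<^esub> \<phi> b) (A \<union> A')"
      using c d \<phi> by (intro M.finsum_addf) (auto simp: coords_on_def Pi_iff subset_iff)
    finally show ?thesis
      by (simp add: lin_ext_eq[OF c \<phi>] lin_ext_eq[OF d \<phi>] lin_ext_eq[OF coords_on_add[OF c d] \<phi>])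
  qed
  show "lin_ext \<phi> (r \<odot>\<^bsub>M\<^esub> x) = r \<odot>\<^bsub>M\<^esub> lin_ext \<phi> x" if rx: "r \<in> carrier R" "x \<in> carrier M" for r x
  proof -
    obtain A c where c: "coords_on A c x" using rx coords_on_ex by metis
    have "r \<odot>\<^bsub>M\<^esub> finsum M (\<lambda>b. c b \<odot>\<^bsub>M\<^esub> \<phi> b) A = finsum M (\<lambda>b. r \<odot>\<^bsub>M\<^esub> (c b \<odot>\<^bsub>M\<^esub> \<phi> b)) A"
      using c \<phi> rx by (intro smult_finsum) (auto simp: coords_on_def Pi_iff subset_iff)
    also have "\<dots> = finsum M (\<lambda>b. (r \<otimes> c b) \<odot>\<^bsub>M\<^esub> \<phi> b) A"
      using c \<phi> rx by (intro M.finsum_cong') (auto simp: coords_on_def smult_assoc1 Pi_iff subset_iff)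
    finally show ?thesis
      by (simp add: lin_ext_eq[OF c \<phi>] lin_ext_eq[OF coords_on_smult[OF c rx(1)] \<phi>])
  qed
qed

lemma lin_ext_basis:
  assumes \<phi>: "\<phi> \<in> B \<rightarrow> carrier M" and b: "b \<in> B"
  shows "lin_ext \<phi> b = \<phi> b"
proof -
  have "coords_on {b} (\<lambda>b'. if b' = b then \<one> else \<zero>) b"
    using b by (simp add: coords_on_def)
  from lin_ext_eq[OF this \<phi>] show ?thesis using \<phi> b by (auto simp: Pi_iff)
qed

lemma endo_basis_eqI:
  assumes fg: "f \<in> carrier E" "g \<in> carrier E" and eq: "\<And>b. b \<in> B \<Longrightarrow> f b = g b"
  shows "f = g"
proof (rule endo_eqI[OF fg])
  fix x assume "x \<in> carrier M"
  then obtain A c where A: "coords_on A c x" using coords_on_ex by blast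
  then have "h x = finsum M (\<lambda>b. c b \<odot>\<^bsub>M\<^esub> h b) A" if "h \<in> carrier E" for h
  proof -
    have "h x = finsum M (\<lambda>b. h (c b \<odot>\<^bsub>M\<^esub> b)) A"
      using A that by (auto simp: coords_on_def intro!: endo_finsum)
    also have "\<dots> = finsum M (\<lambda>b. c b \<odot>\<^bsub>M\<^esub> h b) A"
      using A that by (intro M.finsum_cong') (auto simp: coords_on_def endo_smult subset_iff)
    finally show ?thesis .
  qed
  moreover have "finsum M (\<lambda>b. c b \<odot>\<^bsub>M\<^esub> f b) A = finsum M (\<lambda>b. c b \<odot>\<^bsub>M\<^esub> g b) A"
    using A fg eq by (intro M.finsum_cong') (auto simp: coords_on_def subset_iff)
  ultimately show "f x = g x" using fg by simp
qed

text \<open>The universal property of a basis, with the basis relabelled by an index set \<open>S\<close>. Maps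
  on an infinite basis are given below through bijections of it with product sets.\<close>

lemma endo_along_bij:
  assumes k: "bij_betw k S B" and g: "\<And>s. s \<in> S \<Longrightarrow> g s \<in> carrier M"
  shows "\<exists>f\<in>carrier E. \<forall>s\<in>S. f (k s) = g s"
proof -
  let ?\<phi> = "\<lambda>b. g (the_inv_into S k b)"
  have \<phi>: "?\<phi> \<in> B \<rightarrow> carrier M"
    using g bij_betw_the_inv_into[OF k] by (auto simp: bij_betw_def)
  have "lin_ext ?\<phi> (k s) = g s" if "s \<in> S" for s
    using that k lin_ext_basis[OF \<phi>, of "k s"] by (auto simp: bij_betw_def the_inv_into_f_f)
  with lin_ext_endo[OF \<phi>] show ?thesis by blast
qed

lemma E_one_neq_zero:
  assumes "infinite B"
  shows "\<one>\<^bsub>E\<^esub> \<noteq> \<zero>\<^bsub>E\<^esub>"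
proof
  assume eq: "\<one>\<^bsub>E\<^esub> = \<zero>\<^bsub>E\<^esub>"
  have "b = \<zero>\<^bsub>M\<^esub>" if "b \<in> B" for b
    using arg_cong[OF eq, of "\<lambda>f. f b"] that by simp
  then have "B \<subseteq> {\<zero>\<^bsub>M\<^esub>}" by blast
  with assms show False using finite_subset by blast
qed

text \<open>Arrange the basis as \<open>e (n, b)\<close> with \<open>n\<close> natural, and let \<open>s\<close> lower \<open>n\<close> by one and \<open>t\<close>
  raise it, so that \<open>s t = 1\<close> and \<open>s\<close> is locally nilpotent. Then \<open>s w - w s = d\<close> has the
  locally finite solution \<open>w = \<Sum>n. t\<^bsup>n+1\<^esup> d s\<^bsup>n\<^esup>\<close>.\<close>

lemma backward_shift:
  assumes "infinite B"
  shows "\<exists>s\<in>carrier E. \<forall>d\<in>carrier E. \<exists>w\<in>carrier E. s \<otimes>\<^bsub>E\<^esub> w = d \<oplus>\<^bsub>E\<^esub> w \<otimes>\<^bsub>E\<^esub> s"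
proof -
  interpret E: ring E by (rule E_ring)
  have "|UNIV :: nat set| \<le>o |B|" using assms infinite_iff_card_of_nat by blast
  then have "|(UNIV :: nat set) \<times> B| =o |B|"
    using assms by (intro card_of_Times_infinite[THEN conjunct2]) auto
  then obtain e :: "nat \<times> 'c \<Rightarrow> 'c" where e: "bij_betw e (UNIV \<times> B) B"
    using card_of_ordIso by blast
  have eB [simp]: "e (n, b) \<in> B" if "b \<in> B" for n b
    using e that by (auto simp: bij_betw_def)
  have eq_on_e: "f = g" if "f \<in> carrier E" "g \<in> carrier E" "\<And>n b. b \<in> B \<Longrightarrow> f (e (n, b)) = g (e (n, b))" for f g
  proof (rule endo_basis_eqI[OF that(1,2)])
    fix b assume "b \<in> B"
    then have "b \<in> e ` (UNIV \<times> B)" using e by (simp add: bij_betw_def)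
    then obtain n b' where "b' \<in> B" "b = e (n, b')" by auto
    then show "f b = g b" using that(3) by simp
  qed
  have "(case x of (n, b) \<Rightarrow> case n of 0 \<Rightarrow> \<zero>\<^bsub>M\<^esub> | Suc m \<Rightarrow> e (m, b)) \<in> carrier M" if "x \<in> UNIV \<times> B" for x
    using that by (auto split: nat.split)
  then obtain s where s: "s \<in> carrier E" and
    "\<forall>x\<in>UNIV \<times> B. s (e x) = (case x of (n, b) \<Rightarrow> case n of 0 \<Rightarrow> \<zero>\<^bsub>M\<^esub> | Suc m \<Rightarrow> e (m, b))"
    using endo_along_bij[OF e, of "\<lambda>(n, b). case n of 0 \<Rightarrow> \<zero>\<^bsub>M\<^esub> | Suc m \<Rightarrow> e (m, b)"]
    by blast
  then have s_e: "s (e (0, b)) = \<zero>\<^bsub>M\<^esub>" "s (e (Suc n, b)) = e (n, b)" if "b \<in> B" for n b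
    using that by force+
  obtain t where t: "t \<in> carrier E" and
    "\<forall>x\<in>UNIV \<times> B. t (e x) = (case x of (n, b) \<Rightarrow> e (Suc n, b))"
    using endo_along_bij[OF e, of "\<lambda>(n, b). e (Suc n, b)"] by auto
  then have t_e: "t (e (n, b)) = e (Suc n, b)" if "b \<in> B" for n b
    using that by force
  have "s \<otimes>\<^bsub>E\<^esub> t = \<one>\<^bsub>E\<^esub>"
    using s t by (intro eq_on_e) (simp_all add: s_e t_e)
  then have st: "s (t x) = x" if "x \<in> carrier M" for x
    using that by (metis E_mult_apply E_one_apply)
  have "\<exists>w\<in>carrier E. s \<otimes>\<^bsub>E\<^esub> w = d \<oplus>\<^bsub>E\<^esub> w \<otimes>\<^bsub>E\<^esub> s" if d: "d \<in> carrier E" for d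
  proof -
    \<comment> \<open>the values of \<open>w = t d + t w s\<close> on the basis, by recursion on the level \<open>n\<close>\<close>
    define W where "W n b = rec_nat (t (d (e (0, b)))) (\<lambda>m w. t (d (e (Suc m, b)) \<oplus>\<^bsub>M\<^esub> w)) n" for n b
    have W: "W 0 b = t (d (e (0, b)))" "W (Suc n) b = t (d (e (Suc n, b)) \<oplus>\<^bsub>M\<^esub> W n b)" for n b
      by (simp_all add: W_def)
    have W_closed: "W n b \<in> carrier M" if "b \<in> B" for n b
      using that d t by (induction n) (simp_all add: W)
    obtain w where w: "w \<in> carrier E" and "\<forall>x\<in>UNIV \<times> B. w (e x) = (case x of (n, b) \<Rightarrow> W n b)"
      using endo_along_bij[OF e, of "\<lambda>(n, b). W n b"] W_closed by auto
    then have w_e: "w (e (n, b)) = W n b" if "b \<in> B" for n b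
      using that by force
    have "s \<otimes>\<^bsub>E\<^esub> w = d \<oplus>\<^bsub>E\<^esub> w \<otimes>\<^bsub>E\<^esub> s"
    proof (rule eq_on_e)
      fix n b assume b: "b \<in> B"
      show "(s \<otimes>\<^bsub>E\<^esub> w) (e (n, b)) = (d \<oplus>\<^bsub>E\<^esub> w \<otimes>\<^bsub>E\<^esub> s) (e (n, b))"
        using b d w by (cases n) (simp_all add: w_e W st s_e W_closed endo_zero)
    qed (use s w d in simp_all)
    with w show ?thesis by blast
  qed
  with s show ?thesis by blast
qed

text \<open>A bijection between the basis and three copies of it splits the module into three
  copies of itself; \<open>q i\<close> is the inclusion of the \<open>i\<close>-th copy and \<open>p i\<close> the projection.\<close>

lemma End_matrix_like:
  assumes "infinite B"
  shows "\<exists>p q s. matrix_like_ring E p q s"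
proof -
  interpret E: ring E by (rule E_ring)
  have "|{1..3::int}| \<le>o |B|" using assms 
    by (intro ordLess_imp_ordLeq finite_ordLess_infinite_set) simp_all
  then have "|{1..3::int} \<times> B| =o |B|"
    using assms by (intro card_of_Times_infinite[THEN conjunct2]) auto
  then obtain k :: "int \<times> 'c \<Rightarrow> 'c" where k: "bij_betw k ({1..3} \<times> B) B"
    using card_of_ordIso by blast
  have kB [simp]: "k (i, b) \<in> B" if "i \<in> {1..3}" "b \<in> B" for i b
    using k that by (auto simp: bij_betw_def)
  have "\<exists>f. f \<in> carrier E \<and> (\<forall>j\<in>{1..3}. \<forall>b\<in>B. f (k (j, b)) = (if i = j then b else \<zero>\<^bsub>M\<^esub>))" for i
  proof -
    have "\<exists>f\<in>carrier E. \<forall>x\<in>{1..3}\<times>B. f (k x) = (if i = fst x then snd x else \<zero>\<^bsub>M\<^esub>)"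
      by (rule endo_along_bij[OF k]) auto
    then show ?thesis by force
  qed
  then obtain p where p: "p i \<in> carrier E"
    and p_k: "j \<in> {1..3} \<Longrightarrow> b \<in> B \<Longrightarrow> p i (k (j, b)) = (if i = j then b else \<zero>\<^bsub>M\<^esub>)" for i j b
    by metis
  have "\<exists>f. f \<in> carrier E \<and> (\<forall>b\<in>B. f b = (if i \<in> {1..3} then k (i, b) else \<zero>\<^bsub>M\<^esub>))" for i
  proof -
    have "\<exists>f\<in>carrier E. \<forall>b\<in>B. f (id b) = (if i \<in> {1..3} then k (i, b) else \<zero>\<^bsub>M\<^esub>)"
      by (rule endo_along_bij[OF bij_betw_id]) auto
    then show ?thesis by auto
  qed
  then obtain q where q: "q i \<in> carrier E"
    and "b \<in> B \<Longrightarrow> q i b = (if i \<in> {1..3} then k (i, b) else \<zero>\<^bsub>M\<^esub>)" for i b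
    by metis
  then have q_b: "q i b = k (i, b)" if "i \<in> {1..3}" "b \<in> B" for i b using that by simp
  obtain s where s: "s \<in> carrier E" and
    s_surj: "\<And>d. d \<in> carrier E \<Longrightarrow> \<exists>w\<in>carrier E. s \<otimes>\<^bsub>E\<^esub> w = d \<oplus>\<^bsub>E\<^esub> w \<otimes>\<^bsub>E\<^esub> s"
    using backward_shift[OF assms] by blast
  have "matrix_like_ring E p q s"
  proof
    fix i j :: int assume ij: "i \<in> {1..3}" "j \<in> {1..3}"
    show "p i \<otimes>\<^bsub>E\<^esub> q j = (if i = j then \<one>\<^bsub>E\<^esub> else \<zero>\<^bsub>E\<^esub>)"
      using p q ij by (intro endo_basis_eqI) (simp_all add: q_b p_k)
  next
    show "q 1 \<otimes>\<^bsub>E\<^esub> p 1 \<oplus>\<^bsub>E\<^esub> q 2 \<otimes>\<^bsub>E\<^esub> p 2 \<oplus>\<^bsub>E\<^esub> q 3 \<otimes>\<^bsub>E\<^esub> p 3 = \<one>\<^bsub>E\<^esub>"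
    proof (rule endo_basis_eqI)
      fix b assume "b \<in> B"
      then have "b \<in> k ` ({1..3} \<times> B)" using k by (simp add: bij_betw_def)
      then obtain j c where jc: "j \<in> {1..3}" "c \<in> B" "b = k (j, c)" by blast
      then have "j = 1 \<or> j = 2 \<or> j = 3" by auto
      then show "(q 1 \<otimes>\<^bsub>E\<^esub> p 1 \<oplus>\<^bsub>E\<^esub> q 2 \<otimes>\<^bsub>E\<^esub> p 2 \<oplus>\<^bsub>E\<^esub> q 3 \<otimes>\<^bsub>E\<^esub> p 3) b = \<one>\<^bsub>E\<^esub> b"
        using jc q by (elim disjE) (simp_all add: p_k q_b endo_zero)
    qed (use p q in simp_all)
  qed (use p q s s_surj E_one_neq_zero[OF assms] in auto)
  then show ?thesis by blast
qed

end

section \<open>Existence of bases and dimension over division rings\<close>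

context left_module begin

text \<open>Used for the image of an endomorphism, whose dimension is by definition that of the
  substructure it carries.\<close>

lemma submodule_left_module:
  assumes sub: "H \<subseteq> carrier M" and zero: "\<zero>\<^bsub>M\<^esub> \<in> H"
    and add: "\<And>x y. x \<in> H \<Longrightarrow> y \<in> H \<Longrightarrow> x \<oplus>\<^bsub>M\<^esub> y \<in> H"
    and smult: "\<And>c x. c \<in> carrier R \<Longrightarrow> x \<in> H \<Longrightarrow> c \<odot>\<^bsub>M\<^esub> x \<in> H"
  shows "left_module R (M\<lparr>carrier := H\<rparr>)"
proof -
  have carr: "x \<in> carrier M" if "x \<in> H" for x using that sub by blast
  have "abelian_group (M\<lparr>carrier := H\<rparr>)"
  proof (rule abelian_groupI)
    fix x assume x: "x \<in> carrier (M\<lparr>carrier := H\<rparr>)"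
    then have "(\<ominus> \<one>) \<odot>\<^bsub>M\<^esub> x \<oplus>\<^bsub>M\<^esub> x = \<zero>\<^bsub>M\<^esub>"
      by (simp add: carr smult_l_minus M.l_neg)
    moreover have "(\<ominus> \<one>) \<odot>\<^bsub>M\<^esub> x \<in> H" using x by (simp add: smult)
    ultimately show "\<exists>y\<in>carrier (M\<lparr>carrier := H\<rparr>). y \<oplus>\<^bsub>M\<lparr>carrier := H\<rparr>\<^esub> x = \<zero>\<^bsub>M\<lparr>carrier := H\<rparr>\<^esub>"
      by auto
  qed (use zero add in \<open>auto simp: carr M.a_ac\<close>)
  then show ?thesis
    by (intro left_module.intro left_module_axioms.intro R.ring_axioms)
       (auto simp: carr smult smult_l_distr smult_r_distr smult_assoc1)
qed

text \<open>Finite sums refer to the carrier of their structure, so the sum in a submodule is not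
  the ambient sum by definition.\<close>

lemma finsum_submodule:
  assumes "left_module R (M\<lparr>carrier := H\<rparr>)" "H \<subseteq> carrier M"
    and "finite A" "\<And>b. b \<in> A \<Longrightarrow> f b \<in> H"
  shows "finsum (M\<lparr>carrier := H\<rparr>) f A = finsum M f A"
proof -
  interpret H: left_module R "M\<lparr>carrier := H\<rparr>" by fact
  show ?thesis using assms(3,4)
  proof (induction A rule: finite_induct)
    case empty
    then show ?case using H.M.finsum_empty[of f] by simp
  next
    case (insert b A)
    then have "f \<in> A \<rightarrow> H" "f b \<in> H" by auto
    then have "f \<in> A \<rightarrow> carrier M" "f b \<in> carrier M" using assms(2) by auto
    with insert \<open>f \<in> A \<rightarrow> H\<close> show ?case
      using H.M.finsum_insert[of A b f] by simp
  qed
qed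

definition independent :: "'b set \<Rightarrow> bool" where
  "independent C \<longleftrightarrow> C \<subseteq> carrier M \<and> (\<forall>A c. finite A \<longrightarrow> A \<subseteq> C \<longrightarrow> c \<in> A \<rightarrow> carrier R \<longrightarrow>
        finsum M (\<lambda>b. c b \<odot>\<^bsub>M\<^esub> b) A = \<zero>\<^bsub>M\<^esub> \<longrightarrow> (\<forall>b\<in>A. c b = \<zero>))"

definition spans :: "'b set \<Rightarrow> 'b \<Rightarrow> bool" where
  "spans C x \<longleftrightarrow> (\<exists>A c. finite A \<and> A \<subseteq> C \<and> c \<in> A \<rightarrow> carrier R \<and> x = finsum M (\<lambda>b. c b \<odot>\<^bsub>M\<^esub> b) A)"

lemma module_basis_iff: "module_basis R M B \<longleftrightarrow> independent B \<and> (\<forall>x\<in>carrier M. spans B x)"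
  by (auto simp: module_basis_def independent_def spans_def)

lemma spans_base: "C \<subseteq> carrier M \<Longrightarrow> x \<in> C \<Longrightarrow> spans C x"
  unfolding spans_def by (intro exI[of _ "{x}"] exI[of _ "\<lambda>_. \<one>"]) auto

lemma spans_smult:
  assumes "C \<subseteq> carrier M" "r \<in> carrier R" "spans C x"
  shows "spans C (r \<odot>\<^bsub>M\<^esub> x)"
proof -
  obtain A c where A: "finite A" "A \<subseteq> C" "c \<in> A \<rightarrow> carrier R" "x = finsum M (\<lambda>b. c b \<odot>\<^bsub>M\<^esub> b) A"
    using assms(3) by (auto simp: spans_def)
  have cl: "c b \<in> carrier R" "b \<in> carrier M" if "b \<in> A" for b using A that assms(1) by auto
  have "r \<odot>\<^bsub>M\<^esub> x = finsum M (\<lambda>b. r \<odot>\<^bsub>M\<^esub> (c b \<odot>\<^bsub>M\<^esub> b)) A"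
    unfolding A(4) using A(1) assms(2) cl by (intro smult_finsum) auto
  also have "\<dots> = finsum M (\<lambda>b. (r \<otimes> c b) \<odot>\<^bsub>M\<^esub> b) A"
    using assms(2) cl by (intro M.finsum_cong') (auto simp: smult_assoc1)
  finally show ?thesis
    unfolding spans_def using A(1,2) cl assms(2) by (intro exI[of _ A] exI[of _ "\<lambda>b. r \<otimes> c b"]) auto
qed

lemma endo_kills_span:
  assumes f: "f \<in> carrier E" and C: "C \<subseteq> carrier M" "\<And>c. c \<in> C \<Longrightarrow> f c = \<zero>\<^bsub>M\<^esub>" and x: "spans C x"
  shows "f x = \<zero>\<^bsub>M\<^esub>"
proof -
  obtain A c where A: "finite A" "A \<subseteq> C" "c \<in> A \<rightarrow> carrier R" "x = finsum M (\<lambda>b. c b \<odot>\<^bsub>M\<^esub> b) A"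
    using x by (auto simp: spans_def)
  have cl: "c b \<in> carrier R" "b \<in> carrier M" "f b = \<zero>\<^bsub>M\<^esub>" if "b \<in> A" for b using A that C by auto
  have "f x = finsum M (\<lambda>b. f (c b \<odot>\<^bsub>M\<^esub> b)) A"
    unfolding A(4) using A(1) f cl by (intro endo_finsum) auto
  also have "\<dots> = finsum M (\<lambda>b. \<zero>\<^bsub>M\<^esub>) A"
    using f cl by (intro M.finsum_cong') (auto simp: endo_smult)
  finally show ?thesis by simp
qed

end

text \<open>Left vector spaces over a division ring: left inverses are what it takes to solve a
  linear relation for one of its vectors.\<close>

locale division_module = left_module +
  assumes left_inverse: "\<lbrakk>c \<in> carrier R; c \<noteq> \<zero>\<rbrakk> \<Longrightarrow> \<exists>d\<in>carrier R. d \<otimes> c = \<one>"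
begin

text \<open>A nonzero coefficient at \<open>x\<close> in a relation could be inverted to put \<open>x\<close> in the span.\<close>

lemma independent_insert:
  assumes B: "independent B" and x: "x \<in> carrier M" and nsp: "\<not> spans B x"
  shows "independent (insert x B)"
proof -
  have B_sub: "B \<subseteq> carrier M" using B by (simp add: independent_def)
  have indep: "\<forall>b\<in>A. c b = \<zero>" if "finite A" "A \<subseteq> B" "c \<in> A \<rightarrow> carrier R" "finsum M (\<lambda>b. c b \<odot>\<^bsub>M\<^esub> b) A = \<zero>\<^bsub>M\<^esub>" for A c
    using B that unfolding independent_def by blast
  have "\<forall>b\<in>A. c b = \<zero>" if A: "finite A" "A \<subseteq> insert x B" "c \<in> A \<rightarrow> carrier R" "finsum M (\<lambda>b. c b \<odot>\<^bsub>M\<^esub> b) A = \<zero>\<^bsub>M\<^esub>" for A c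
  proof (cases "x \<in> A")
    case False
    with A indep[of A c] show ?thesis by blast
  next
    case True
    let ?A = "A - {x}"
    define y where "y = finsum M (\<lambda>b. c b \<odot>\<^bsub>M\<^esub> b) ?A"
    have A': "finite ?A" "?A \<subseteq> B" "c \<in> ?A \<rightarrow> carrier R" and cx: "c x \<in> carrier R"
      using A True by auto
    have cl: "c b \<odot>\<^bsub>M\<^esub> b \<in> carrier M" if "b \<in> ?A" for b using A' B_sub that by (intro smult_closed) auto
    have y: "y \<in> carrier M" "spans B y"
      unfolding y_def spans_def using A' cl by (auto intro!: M.finsum_closed)
    have sum: "c x \<odot>\<^bsub>M\<^esub> x \<oplus>\<^bsub>M\<^esub> y = \<zero>\<^bsub>M\<^esub>"
      using M.finsum_insert[of ?A x "\<lambda>b. c b \<odot>\<^bsub>M\<^esub> b"] A(4) A' cl cx x True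
      by (simp add: y_def insert_absorb)
    have "c x = \<zero>"
    proof (rule ccontr)
      assume "c x \<noteq> \<zero>"
      then obtain d where d: "d \<in> carrier R" "d \<otimes> c x = \<one>" using left_inverse cx by blast
      have "c x \<odot>\<^bsub>M\<^esub> x = (\<ominus> \<one>) \<odot>\<^bsub>M\<^esub> y"
        using sum cx x y by (simp add: smult_l_minus M.minus_equality)
      then have "x = d \<odot>\<^bsub>M\<^esub> ((\<ominus> \<one>) \<odot>\<^bsub>M\<^esub> y)"
        using d cx x by (metis smult_assoc1 smult_one)
      then have "spans B x" using spans_smult[OF B_sub] y(2) d by (metis R.a_inv_closed R.one_closed)
      with nsp show False by contradiction
    qed
    moreover from this have "finsum M (\<lambda>b. c b \<odot>\<^bsub>M\<^esub> b) ?A = \<zero>\<^bsub>M\<^esub>"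
      using sum x y by (simp add: y_def)
    ultimately show ?thesis using indep[OF A'] by blast
  qed
  then show ?thesis using x B_sub unfolding independent_def by blast
qed

lemma independent_extends_to_basis:
  assumes C: "independent C"
  shows "\<exists>B. C \<subseteq> B \<and> module_basis R M B"
proof -
  let ?\<A> = "{B. C \<subseteq> B \<and> independent B}"
  have "\<exists>B\<in>?\<A>. \<forall>X\<in>?\<A>. B \<subseteq> X \<longrightarrow> X = B"
  proof (rule subset_Zorn_nonempty)
    show "?\<A> \<noteq> {}" using C by blast
  next
    fix \<C> assume \<C>: "\<C> \<noteq> {}" "subset.chain ?\<A> \<C>"
    then have mem: "C \<subseteq> X" "independent X" if "X \<in> \<C>" for X
      using that unfolding subset_chain_def by auto
    have "\<forall>b\<in>A. c b = \<zero>" if A: "finite A" "A \<subseteq> \<Union>\<C>" "c \<in> A \<rightarrow> carrier R"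
      "finsum M (\<lambda>b. c b \<odot>\<^bsub>M\<^esub> b) A = \<zero>\<^bsub>M\<^esub>" for A c
    proof -
      obtain X where "X \<in> \<C>" "A \<subseteq> X" using finite_subset_Union_chain[OF A(1,2) \<C>] by blast
      then show ?thesis using A mem(2)[of X] unfolding independent_def by blast
    qed
    moreover have "\<Union>\<C> \<subseteq> carrier M" using mem(2) unfolding independent_def by blast
    ultimately have "independent (\<Union>\<C>)" unfolding independent_def by blast
    then show "\<Union>\<C> \<in> ?\<A>" using \<C>(1) mem(1) by blast
  qed
  then obtain B where B: "C \<subseteq> B" "independent B" and max: "\<And>X. C \<subseteq> X \<Longrightarrow> independent X \<Longrightarrow> B \<subseteq> X \<Longrightarrow> X = B"
    by auto
  have sub: "B \<subseteq> carrier M" using B by (simp add: independent_def)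
  have "spans B x" if x: "x \<in> carrier M" for x
  proof (rule ccontr)
    assume n: "\<not> spans B x"
    then have "insert x B = B" using max[of "insert x B"] independent_insert[OF B(2) x] B(1) by blast
    then show False using n spans_base[OF sub] by blast
  qed
  with B show ?thesis by (auto simp: module_basis_iff)
qed

lemma vs_dim_basis: "\<exists>B. module_basis R M B \<and> vs_dim R M = |B|"
proof -
  have "independent {}" by (simp add: independent_def)
  then have "\<exists>B. module_basis R M B" using independent_extends_to_basis by blast
  then have "module_basis R M (SOME B. module_basis R M B)" by (rule someI_ex)
  then show ?thesis unfolding vs_dim_def by blast
qed

text \<open>The basis of the image that the dimension refers to is a basis of a substructure; here
  its properties are expressed in the ambient module.\<close>

lemma image_dim_basis:
  assumes f: "f \<in> carrier E"
  shows "\<exists>C. vs_dim R (M\<lparr>carrier := f ` carrier M\<rparr>) = |C| \<and> independent C \<and>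
     C \<subseteq> f ` carrier M \<and> (\<forall>x\<in>carrier M. spans C (f x))"
proof -
  let ?H = "f ` carrier M"
  have sub: "?H \<subseteq> carrier M" using f by auto
  have lm: "left_module R (M\<lparr>carrier := ?H\<rparr>)"
  proof (rule submodule_left_module[OF sub])
    show "\<zero>\<^bsub>M\<^esub> \<in> ?H" using endo_zero[OF f] by (metis M.zero_closed imageI)
  next
    fix x y assume "x \<in> ?H" "y \<in> ?H"
    then show "x \<oplus>\<^bsub>M\<^esub> y \<in> ?H" using f by (auto simp flip: endo_add)
  next
    fix c x assume "c \<in> carrier R" "x \<in> ?H"
    then show "c \<odot>\<^bsub>M\<^esub> x \<in> ?H" using f by (auto simp flip: endo_smult)
  qed
  then interpret H: division_module R "M\<lparr>carrier := ?H\<rparr>"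
    by (intro division_module.intro division_module_axioms.intro left_inverse)
  obtain C where C: "module_basis R (M\<lparr>carrier := ?H\<rparr>) C" "vs_dim R (M\<lparr>carrier := ?H\<rparr>) = |C|"
    using H.vs_dim_basis by blast
  have CH: "C \<subseteq> ?H" using C(1) by (simp add: module_basis_def)
  have sums: "finsum (M\<lparr>carrier := ?H\<rparr>) (\<lambda>b. c b \<odot>\<^bsub>M\<^esub> b) A = finsum M (\<lambda>b. c b \<odot>\<^bsub>M\<^esub> b) A"
    if "finite A" "A \<subseteq> C" "c \<in> A \<rightarrow> carrier R" for A c
    using that CH H.smult_closed by (intro finsum_submodule[OF lm sub]) (auto simp: Pi_iff subset_iff)
  have "independent C"
    using C(1) CH sub sums unfolding independent_def module_basis_def by simp
  moreover have "spans C (f x)" if x: "x \<in> carrier M" for x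
  proof -
    have "f x \<in> carrier (M\<lparr>carrier := ?H\<rparr>)" using x by simp
    then obtain A c where "finite A" "A \<subseteq> C" "c \<in> A \<rightarrow> carrier R"
      "f x = finsum (M\<lparr>carrier := ?H\<rparr>) (\<lambda>b. c b \<odot>\<^bsub>M\<^esub> b) A"
      using C(1) unfolding module_basis_def by auto
    with sums show ?thesis unfolding spans_def by auto
  qed
  ultimately show ?thesis using C(2) CH by blast
qed

end

context based_module begin

text \<open>A basis containing zero forces \<open>1 = 0\<close> in the scalars; then the module is zero and has no
  infinite subset.\<close>

lemma infinite_basis_nonzero:
  assumes "infinite B" "b \<in> B"
  shows "b \<noteq> \<zero>\<^bsub>M\<^esub>"
proof
  assume b: "b = \<zero>\<^bsub>M\<^esub>"
  have "\<one> = \<zero>" using indepD[of "{b}" "\<lambda>_. \<one>" b] assms(2) b by simp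
  then have "x = \<zero>\<^bsub>M\<^esub>" if "x \<in> B" for x
    using smult_one[of x] smult_l_null[of x] that by simp
  then have "B \<subseteq> {\<zero>\<^bsub>M\<^esub>}" by blast
  with assms(1) show False using finite_subset by blast
qed

text \<open>A spanning set \<open>S\<close> is at least as large as an infinite basis \<open>B\<close>: the finite supports
  of its members must cover \<open>B\<close>, as otherwise the projection to an uncovered basis vector
  would vanish on \<open>S\<close>. What spanning gives is stated in the form that an endomorphism vanishing
  on \<open>S\<close> is zero, which is easy to verify for a set \<open>S\<close> that is itself an image.\<close>

lemma basis_le_separating:
  assumes inf: "infinite B" and S: "S \<subseteq> carrier M"
    and sep: "\<And>f. f \<in> carrier E \<Longrightarrow> (\<And>s. s \<in> S \<Longrightarrow> f s = \<zero>\<^bsub>M\<^esub>) \<Longrightarrow> f = \<zero>\<^bsub>E\<^esub>"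
  shows "|B| \<le>o |S|"
proof -
  have "\<exists>A c. coords_on A c s" if "s \<in> S" for s using S that coords_on_ex by blast
  then obtain supp c where supp: "\<And>s. s \<in> S \<Longrightarrow> coords_on (supp s) (c s) s" by metis
  have fin: "finite (supp s)" if "s \<in> S" for s using supp[OF that] by (simp add: coords_on_def)
  have "B \<subseteq> (\<Union>s\<in>S. supp s)"
  proof (rule ccontr)
    assume "\<not> B \<subseteq> (\<Union>s\<in>S. supp s)"
    then obtain b where b: "b \<in> B" "\<And>s. s \<in> S \<Longrightarrow> b \<notin> supp s" by blast
    let ?\<phi> = "\<lambda>b'. if b' = b then b else \<zero>\<^bsub>M\<^esub>"
    have \<phi>: "?\<phi> \<in> B \<rightarrow> carrier M" by auto
    have "lin_ext ?\<phi> s = \<zero>\<^bsub>M\<^esub>" if s: "s \<in> S" for s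
    proof -
      have "finsum M (\<lambda>b'. c s b' \<odot>\<^bsub>M\<^esub> ?\<phi> b') (supp s) = finsum M (\<lambda>_. \<zero>\<^bsub>M\<^esub>) (supp s)"
        using supp[OF s] b(2)[OF s] by (intro M.finsum_cong') (auto simp: coords_on_def)
      then show ?thesis using lin_ext_eq[OF supp[OF s] \<phi>] by simp
    qed
    then have "lin_ext ?\<phi> = \<zero>\<^bsub>E\<^esub>" using sep lin_ext_endo[OF \<phi>] by blast
    then have "b = \<zero>\<^bsub>M\<^esub>" using lin_ext_basis[OF \<phi> b(1)] b(1) by simp
    with infinite_basis_nonzero[OF inf b(1)] show False by contradiction
  qed
  then have le: "|B| \<le>o |\<Union>s\<in>S. supp s|" by (rule card_of_mono1)
  have infS: "infinite S"
  proof
    assume "finite S"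
    then have "finite (\<Union>s\<in>S. supp s)" using fin by blast
    with \<open>B \<subseteq> (\<Union>s\<in>S. supp s)\<close> inf show False using finite_subset by blast
  qed
  then have "\<forall>s\<in>S. |supp s| \<le>o |S|"
    using fin finite_ordLess_infinite_set ordLess_imp_ordLeq by blast
  then have "|\<Union>s\<in>S. supp s| \<le>o |S|"
    by (rule card_of_UNION_ordLeq_infinite[OF infS ordIso_imp_ordLeq[OF card_of_refl]])
  with le show ?thesis by (rule ordLeq_transitive)
qed

end

section \<open>The ideal of endomorphisms with small image\<close>

locale infinite_dim_module = division_module R M + based_module R M B
  for R (structure) and M (structure) and B +
  assumes infinite_B: "infinite B" and vs_dim_B: "vs_dim R M = |B|"
begin

abbreviation I where "I \<equiv> small_image_ideal R M"

lemma I_iff: "f \<in> I \<longleftrightarrow> f \<in> carrier E \<and> vs_dim R (M\<lparr>carrier := f ` carrier M\<rparr>) <o |B|"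
  by (simp add: small_image_ideal_def vs_dim_B)

text \<open>If the image of \<open>f\<close> has full dimension, then \<open>B\<close> embeds into a basis \<open>C\<close> of that image.
  The map \<open>h\<close> takes each basis vector to a preimage of its partner in \<open>C\<close>, and \<open>g\<close>, defined
  on a basis of the whole space that extends \<open>C\<close>, takes the partner back.\<close>

lemma factor_one:
  assumes f: "f \<in> carrier E" "f \<notin> I"
  shows "\<exists>g\<in>carrier E. \<exists>h\<in>carrier E. g \<otimes>\<^bsub>E\<^esub> (f \<otimes>\<^bsub>E\<^esub> h) = \<one>\<^bsub>E\<^esub>"
proof -
  interpret E: ring E by (rule E_ring)
  obtain C where C: "vs_dim R (M\<lparr>carrier := f ` carrier M\<rparr>) = |C|" "independent C" "C \<subseteq> f ` carrier M"
    using image_dim_basis[OF f(1)] by blast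
  have "\<not> |C| <o |B|" using f C(1) by (simp add: I_iff)
  then have "|B| \<le>o |C|" by (simp only: not_ordLess_iff_ordLeq card_of_Well_order)
  then obtain j where j: "inj_on j B" "j ` B \<subseteq> C" unfolding card_of_ordLeq[symmetric] by blast
  have "\<forall>b\<in>B. \<exists>x. x \<in> carrier M \<and> f x = j b"
  proof
    fix b assume "b \<in> B"
    then have "j b \<in> f ` carrier M" by (intro subsetD[OF C(3)] subsetD[OF j(2)] imageI)
    then show "\<exists>x. x \<in> carrier M \<and> f x = j b" by (elim imageE) auto
  qed
  then obtain \<psi> where \<psi>: "\<forall>b\<in>B. \<psi> b \<in> carrier M \<and> f (\<psi> b) = j b"
    by (rule bchoice[THEN exE])
  then have \<psi>': "\<psi> \<in> B \<rightarrow> carrier M" by auto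
  obtain C' where C': "C \<subseteq> C'" "module_basis R M C'" using independent_extends_to_basis[OF C(2)] by blast
  interpret C': based_module R M C' by unfold_locales (rule C')
  define \<gamma> where "\<gamma> = (\<lambda>x. if x \<in> j ` B then the_inv_into B j x else \<zero>\<^bsub>M\<^esub>)"
  have \<gamma>: "\<gamma> \<in> C' \<rightarrow> carrier M"
    using the_inv_into_into[OF j(1) _ subset_refl] by (auto simp: \<gamma>_def)
  have "C'.lin_ext \<gamma> \<otimes>\<^bsub>E\<^esub> (f \<otimes>\<^bsub>E\<^esub> lin_ext \<psi>) = \<one>\<^bsub>E\<^esub>"
  proof (rule endo_basis_eqI)
    fix b assume b: "b \<in> B"
    have "C'.lin_ext \<gamma> (j b) = \<gamma> (j b)" using b j C' by (intro C'.lin_ext_basis[OF \<gamma>]) blast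
    also have "\<dots> = b" using b j by (simp add: \<gamma>_def the_inv_into_f_f)
    finally show "(C'.lin_ext \<gamma> \<otimes>\<^bsub>E\<^esub> (f \<otimes>\<^bsub>E\<^esub> lin_ext \<psi>)) b = \<one>\<^bsub>E\<^esub> b"
      using b \<psi> by (simp add: lin_ext_basis[OF \<psi>' b])
  qed (simp_all add: f(1) lin_ext_endo[OF \<psi>'] C'.lin_ext_endo[OF \<gamma>])
  then show ?thesis using lin_ext_endo[OF \<psi>'] C'.lin_ext_endo[OF \<gamma>] by blast
qed

text \<open>If the images of \<open>f1\<close> and \<open>f2\<close> had bases \<open>C1\<close> and \<open>C2\<close> smaller than \<open>B\<close>, then \<open>C1 \<union> C2\<close>
  would be smaller than \<open>B\<close> too, \<open>B\<close> being infinite; but \<open>g\<close> maps it onto a spanning set.\<close>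

lemma sum_not_small:
  assumes E: "f1 \<in> carrier E" "f2 \<in> carrier E" "g \<in> carrier E" "h \<in> carrier E"
    and one: "g \<otimes>\<^bsub>E\<^esub> ((f1 \<oplus>\<^bsub>E\<^esub> f2) \<otimes>\<^bsub>E\<^esub> h) = \<one>\<^bsub>E\<^esub>"
  shows "f1 \<notin> I \<or> f2 \<notin> I"
proof (rule ccontr)
  interpret E: ring E by (rule E_ring)
  assume "\<not> (f1 \<notin> I \<or> f2 \<notin> I)"
  then have small: "f1 \<in> I" "f2 \<in> I" by auto
  obtain C1 where C1: "vs_dim R (M\<lparr>carrier := f1 ` carrier M\<rparr>) = |C1|" "C1 \<subseteq> f1 ` carrier M" "\<And>x. x \<in> carrier M \<Longrightarrow> spans C1 (f1 x)"
    using image_dim_basis[OF E(1)] by blast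
  obtain C2 where C2: "vs_dim R (M\<lparr>carrier := f2 ` carrier M\<rparr>) = |C2|" "C2 \<subseteq> f2 ` carrier M" "\<And>x. x \<in> carrier M \<Longrightarrow> spans C2 (f2 x)"
    using image_dim_basis[OF E(2)] by blast
  have sub: "C1 \<subseteq> carrier M" "C2 \<subseteq> carrier M" using C1(2) C2(2) E by auto
  have lt: "|C1 \<union> C2| <o |B|"
    using small C1(1) C2(1) infinite_B by (intro card_of_Un_ordLess_infinite) (simp_all add: I_iff)
  have "|B| \<le>o |g ` (C1 \<union> C2)|"
  proof (rule basis_le_separating[OF infinite_B])
    show "g ` (C1 \<union> C2) \<subseteq> carrier M" using sub E by auto
  next
    fix f assume f: "f \<in> carrier E" and kill: "\<And>s. s \<in> g ` (C1 \<union> C2) \<Longrightarrow> f s = \<zero>\<^bsub>M\<^esub>"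
    have fg: "f \<otimes>\<^bsub>E\<^esub> g \<in> carrier E" using f E by simp
    have k: "(f \<otimes>\<^bsub>E\<^esub> g) c = \<zero>\<^bsub>M\<^esub>" if "c \<in> C1 \<union> C2" for c
      using kill[of "g c"] that sub by auto
    have "f (g (f1 x)) = \<zero>\<^bsub>M\<^esub>" "f (g (f2 x)) = \<zero>\<^bsub>M\<^esub>" if x: "x \<in> carrier M" for x
      using endo_kills_span[OF fg sub(1) k C1(3)[OF x]] endo_kills_span[OF fg sub(2) k C2(3)[OF x]] x E by simp_all
    then have "f x = \<zero>\<^bsub>M\<^esub>" if x: "x \<in> carrier M" for x
      using arg_cong[OF one, of "\<lambda>u. f (u x)"] x E f by (simp add: endo_add)
    then show "f = \<zero>\<^bsub>E\<^esub>" using f by (intro endo_eqI) auto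
  qed
  also have "|g ` (C1 \<union> C2)| \<le>o |C1 \<union> C2|" by (rule card_of_image)
  also note lt
  finally show False by (simp add: not_ordLess_ordIso ordLess_irreflexive)
qed

lemma zero_in_I: "\<zero>\<^bsub>E\<^esub> \<in> I"
proof -
  interpret E: ring E by (rule E_ring)
  obtain C where C: "vs_dim R (M\<lparr>carrier := \<zero>\<^bsub>E\<^esub> ` carrier M\<rparr>) = |C|" "C \<subseteq> \<zero>\<^bsub>E\<^esub> ` carrier M"
    using image_dim_basis[of "\<zero>\<^bsub>E\<^esub>"] by auto
  then have "C \<subseteq> {\<zero>\<^bsub>M\<^esub>}" by auto
  then have "finite C" using finite_subset by blast
  with C(1) infinite_B show ?thesis by (simp add: I_iff finite_ordLess_infinite_set)
qed

lemma I_factor: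
  assumes E: "f \<in> I" "g \<in> carrier E" "h \<in> carrier E"
  shows "g \<otimes>\<^bsub>E\<^esub> (f \<otimes>\<^bsub>E\<^esub> h) \<noteq> \<one>\<^bsub>E\<^esub>"
proof
  interpret E: ring E by (rule E_ring)
  have f: "f \<in> carrier E" using E by (simp add: I_iff)
  assume "g \<otimes>\<^bsub>E\<^esub> (f \<otimes>\<^bsub>E\<^esub> h) = \<one>\<^bsub>E\<^esub>"
  then have "f \<notin> I \<or> \<zero>\<^bsub>E\<^esub> \<notin> I" using f E by (intro sum_not_small[of f "\<zero>\<^bsub>E\<^esub>" g h]) simp_all
  with E zero_in_I show False by blast
qed

text \<open>By \<open>factor_one\<close> and \<open>I_factor\<close>, \<open>f \<in> I\<close> holds exactly if \<open>1\<close> is not of the form \<open>g f h\<close>, a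
  condition that is plainly stable under multiplication on both sides; closure under
  addition is \<open>sum_not_small\<close>.\<close>

lemma I_ideal: "ideal I E"
proof (rule idealI[OF E_ring])
  interpret E: ring E by (rule E_ring)
  have carr: "f \<in> carrier E" if "f \<in> I" for f using that by (simp add: I_iff)
  have add: "f1 \<oplus>\<^bsub>E\<^esub> f2 \<in> I" if "f1 \<in> I" "f2 \<in> I" for f1 f2
    using factor_one[of "f1 \<oplus>\<^bsub>E\<^esub> f2"] sum_not_small[of f1 f2] carr that by (meson E.add.m_closed)
  show lmult: "x \<otimes>\<^bsub>E\<^esub> f \<in> I" if f: "f \<in> I" and x: "x \<in> carrier E" for f x
  proof (rule ccontr)
    assume "x \<otimes>\<^bsub>E\<^esub> f \<notin> I"
    then obtain g h where "g \<in> carrier E" "h \<in> carrier E" "g \<otimes>\<^bsub>E\<^esub> ((x \<otimes>\<^bsub>E\<^esub> f) \<otimes>\<^bsub>E\<^esub> h) = \<one>\<^bsub>E\<^esub>"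
      using factor_one[of "x \<otimes>\<^bsub>E\<^esub> f"] carr f x by blast
    then show False using I_factor[OF f, of "g \<otimes>\<^bsub>E\<^esub> x" h] carr[OF f] x by (simp add: E.m_assoc)
  qed
  show "f \<otimes>\<^bsub>E\<^esub> x \<in> I" if f: "f \<in> I" and x: "x \<in> carrier E" for f x
  proof (rule ccontr)
    assume "f \<otimes>\<^bsub>E\<^esub> x \<notin> I"
    then obtain g h where "g \<in> carrier E" "h \<in> carrier E" "g \<otimes>\<^bsub>E\<^esub> ((f \<otimes>\<^bsub>E\<^esub> x) \<otimes>\<^bsub>E\<^esub> h) = \<one>\<^bsub>E\<^esub>"
      using factor_one[of "f \<otimes>\<^bsub>E\<^esub> x"] carr f x by blast
    then show False using I_factor[OF f, of g "x \<otimes>\<^bsub>E\<^esub> h"] carr[OF f] x by (simp add: E.m_assoc)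
  qed
  show "subgroup I (add_monoid E)"
  proof (rule E.add.subgroupI)
    show "I \<subseteq> carrier E" using carr by blast
    show "I \<noteq> {}" using zero_in_I by blast
    show "\<ominus>\<^bsub>E\<^esub> f \<in> I" if "f \<in> I" for f
      using lmult[OF that, of "\<ominus>\<^bsub>E\<^esub> \<one>\<^bsub>E\<^esub>"] carr[OF that] by (simp add: E.l_minus)
  qed (rule add)
qed

lemma one_notin_I: "\<one>\<^bsub>E\<^esub> \<notin> I"
proof -
  interpret E: ring E by (rule E_ring)
  show ?thesis using I_factor[of "\<one>\<^bsub>E\<^esub>" "\<one>\<^bsub>E\<^esub>" "\<one>\<^bsub>E\<^esub>"] by auto
qed

lemma proper_ideal_subset_I:
  assumes J: "ideal J E" "J \<noteq> carrier E"
  shows "J \<subseteq> I"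
proof (rule ccontr)
  interpret J: ideal J E by fact
  assume "\<not> J \<subseteq> I"
  then obtain f where f: "f \<in> J" "f \<notin> I" by blast
  then obtain g h where "g \<in> carrier E" "h \<in> carrier E" "g \<otimes>\<^bsub>E\<^esub> (f \<otimes>\<^bsub>E\<^esub> h) = \<one>\<^bsub>E\<^esub>"
    using factor_one[of f] J.Icarr by blast
  then have "\<one>\<^bsub>E\<^esub> \<in> J" using f(1) J.I_l_closed J.I_r_closed by metis
  then show False using J(2) J.one_imp_carrier by blast
qed

lemma I_maximal: "maximalideal I E"
proof (rule maximalidealI[OF I_ideal])
  interpret E: ring E by (rule E_ring)
  show "carrier E \<noteq> I" using one_notin_I by auto
  fix J assume "ideal J E" "I \<subseteq> J" "J \<subseteq> carrier E"
  then show "J = I \<or> J = carrier E" using proper_ideal_subset_I by blast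
qed

lemma I_unique_maximal:
  assumes "maximalideal J E"
  shows "J = I"
proof -
  interpret J: maximalideal J E by fact
  interpret I: maximalideal I E by (rule I_maximal)
  have "J \<subseteq> I" using proper_ideal_subset_I[OF J.ideal_axioms] J.I_notcarr by blast
  then show ?thesis using J.I_maximal[OF I.ideal_axioms] I.I_notcarr I.a_subset by blast
qed

end

section \<open>Quotient rings\<close>

text \<open>The preimage of an ideal of the quotient is an ideal between \<open>I\<close> and \<open>R\<close>, hence
  one of the two.\<close>

lemma (in maximalideal) quotient_simple: "simple_ring (R Quot I)"
proof -
  let ?Q = "R Quot I"
  interpret h: ring_hom_ring R ?Q "(+>) I" by (rule rcos_ring_hom_ring)
  have Q0: "\<zero>\<^bsub>?Q\<^esub> = I" and Q1: "\<one>\<^bsub>?Q\<^esub> = I +> \<one>" and Qc: "carrier ?Q = (+>) I ` carrier R"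
    by (auto simp: FactRing_def A_RCOSETS_def RCOSETS_def a_r_coset_def)
  have "\<one>\<^bsub>?Q\<^esub> \<noteq> \<zero>\<^bsub>?Q\<^esub>"
  proof
    assume "\<one>\<^bsub>?Q\<^esub> = \<zero>\<^bsub>?Q\<^esub>"
    then have "I +> \<one> = I" by (simp only: Q0 Q1)
    then have "\<one> \<in> I" using a_rcos_self[OF one_closed] by (simp only:)
    then show False using one_imp_carrier I_notcarr by blast
  qed
  moreover have "J = {\<zero>\<^bsub>?Q\<^esub>} \<or> J = carrier ?Q" if J: "ideal J ?Q" for J
  proof -
    interpret J: ideal J ?Q by fact
    let ?P = "{r \<in> carrier R. I +> r \<in> J}"
    have P: "ideal ?P R" using h.ideal_vimage[OF J] .
    have J_eq: "J = (+>) I ` ?P" using J.a_subset Qc by auto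
    have IP: "r \<in> ?P" if "r \<in> I" for r
      using that J.zero_closed a_rcos_const[OF that] by (simp add: Q0)
    then have "?P = I \<or> ?P = carrier R" using P by (intro I_maximal) auto
    then show ?thesis
    proof
      assume "?P = I"
      then have "J = (+>) I ` I" using J_eq by simp
      also have "\<dots> = (\<lambda>_. I) ` I" by (rule image_cong[OF refl a_rcos_const])
      also have "\<dots> = {\<zero>\<^bsub>?Q\<^esub>}"
        unfolding Q0 using additive_subgroup.zero_closed[OF is_additive_subgroup] by blast
      finally show ?thesis ..
    qed (use J_eq Qc in simp)
  qed
  ultimately show ?thesis by (simp add: simple_ring_def quotient_is_ring)
qed

lemma (in matrix_like_ring) quotient_matrix_like:
  assumes "ideal I R" "I \<noteq> carrier R"
  shows "matrix_like_ring (R Quot I) (\<lambda>i. I +> p i) (\<lambda>i. I +> q i) (I +> a)"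
proof -
  let ?Q = "R Quot I"
  interpret I: ideal I R by fact
  interpret h: ring_hom_ring R ?Q "(+>) I" by (rule I.rcos_ring_hom_ring)
  have Qc: "carrier ?Q = (+>) I ` carrier R" 
    by (auto simp: FactRing_def A_RCOSETS_def RCOSETS_def a_r_coset_def)
  show ?thesis
  proof
    fix i j :: int assume ij: "i \<in> {1..3}" "j \<in> {1..3}"
    show "(I +> p i) \<otimes>\<^bsub>?Q\<^esub> (I +> q j) = (if i = j then \<one>\<^bsub>?Q\<^esub> else \<zero>\<^bsub>?Q\<^esub>)"
      using p_q[OF ij] by (simp flip: h.hom_mult)
  next
    show "(I +> q 1) \<otimes>\<^bsub>?Q\<^esub> (I +> p 1) \<oplus>\<^bsub>?Q\<^esub> (I +> q 2) \<otimes>\<^bsub>?Q\<^esub> (I +> p 2) \<oplus>\<^bsub>?Q\<^esub> (I +> q 3) \<otimes>\<^bsub>?Q\<^esub> (I +> p 3) = \<one>\<^bsub>?Q\<^esub>"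
      using arg_cong[OF q_p_sum, of "(+>) I"] by simp
  next
    fix D assume "D \<in> carrier ?Q"
    then obtain d where d: "d \<in> carrier R" "D = I +> d" using Qc by auto
    then obtain w where w: "w \<in> carrier R" "a \<otimes> w = d \<oplus> w \<otimes> a" using commutator_surj by blast
    have "(I +> a) \<otimes>\<^bsub>?Q\<^esub> (I +> w) = D \<oplus>\<^bsub>?Q\<^esub> (I +> w) \<otimes>\<^bsub>?Q\<^esub> (I +> a)"
      using arg_cong[OF w(2), of "(+>) I"] d(1) w(1) unfolding d(2) by simp
    then show "\<exists>w\<in>carrier ?Q. (I +> a) \<otimes>\<^bsub>?Q\<^esub> w = D \<oplus>\<^bsub>?Q\<^esub> w \<otimes>\<^bsub>?Q\<^esub> (I +> a)"
      using w(1) by (intro bexI[of _ "I +> w"]) simp_all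
  next
    show "\<one>\<^bsub>?Q\<^esub> \<noteq> \<zero>\<^bsub>?Q\<^esub>"
    proof
      assume "\<one>\<^bsub>?Q\<^esub> = \<zero>\<^bsub>?Q\<^esub>"
      then have "I +> \<one> = I" by (simp only: FactRing_def monoid.simps ring.simps)
      then have "\<one> \<in> I" using I.a_rcos_self[OF one_closed] by (simp only:)
      then show False using I.one_imp_carrier assms(2) by blast
    qed
  qed (simp_all)
qed

lemma division_module_of_vector_space:
  assumes "Ring.field K" "Module.module K V"
  shows "division_module K V"
proof -
  interpret K: Ring.field K by fact
  interpret V: Module.module K V by fact
  have "left_module K V"
    by (intro left_module.intro left_module_axioms.intro K.ring_axioms V.M.abelian_group_axioms)
       (simp_all add: V.smult_l_distr V.smult_r_distr V.smult_assoc1)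
  moreover have "\<exists>d\<in>carrier K. d \<otimes>\<^bsub>K\<^esub> c = \<one>\<^bsub>K\<^esub>" if "c \<in> carrier K" "c \<noteq> \<zero>\<^bsub>K\<^esub>" for c
    using that K.field_Units by (auto simp: Units_def)
  ultimately show ?thesis
    by (intro division_module.intro division_module_axioms.intro)
qed

section \<open>The endomorphism ring of a free module and its simple quotient\<close>

theorem corollary3p6:
  fixes R :: "('r, 'k) ring_scheme" and F :: "('r, 'a, 'm) module_scheme"
    and \<FF> :: "('f, 'l) ring_scheme" and V :: "('f, 'b, 'n) module_scheme"
  shows
    "(left_module R F \<and> free_of_infinite_rank R F \<longrightarrow>
        sum_of_three_nilpotent_subrings 3 (End_ring R F) \<and>
        (\<exists>K L M. braceable_subtruss K (ring_truss (End_ring R F)) \<and>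
           braceable_subtruss L (ring_truss (End_ring R F)) \<and>
           braceable_subtruss M (ring_truss (End_ring R F)) \<and>
           carrier (End_ring R F) = heap_set (ring_truss (End_ring R F)) K L M)) \<and>
     (Ring.field \<FF> \<and> Module.module \<FF> V \<and> cinfinite (vs_dim \<FF> V) \<longrightarrow>
        (let E = End_ring \<FF> V; I = small_image_ideal \<FF> V; Q = E Quot I in
           maximalideal I E \<and> (\<forall>J. maximalideal J E \<longrightarrow> J = I) \<and>
           simple_ring Q \<and>
           sum_of_three_nilpotent_subrings 3 Q \<and>
           (\<exists>K L M. braceable_subtruss K (ring_truss Q) \<and>
              braceable_subtruss L (ring_truss Q) \<and>
              braceable_subtruss M (ring_truss Q) \<and>
              carrier Q = heap_set (ring_truss Q) K L M)))"
proof (intro conjI impI; (elim conjE)?)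
  assume F: "left_module R F" "free_of_infinite_rank R F"
  then obtain B where B: "module_basis R F B" "infinite B" by (auto simp: free_of_infinite_rank_def)
  interpret based_module R F B
    using F(1) B(1) by (intro based_module.intro based_module_axioms.intro)
  obtain p q s where "matrix_like_ring (End_ring R F) p q s" using End_matrix_like[OF B(2)] by blast
  then interpret Q: matrix_like_ring "End_ring R F" p q s .
  show sum: "sum_of_three_nilpotent_subrings 3 (End_ring R F)" by (rule Q.sum_of_three_nilpotent_subrings)
  show "\<exists>K L M. braceable_subtruss K (ring_truss (End_ring R F)) \<and>
           braceable_subtruss L (ring_truss (End_ring R F)) \<and>
           braceable_subtruss M (ring_truss (End_ring R F)) \<and>
           carrier (End_ring R F) = heap_set (ring_truss (End_ring R F)) K L M"
    by (rule Q.sum_of_three_braceable_subtrusses[OF sum])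
next
  assume V: "Ring.field \<FF>" "Module.module \<FF> V" "cinfinite (vs_dim \<FF> V)"
  interpret division_module \<FF> V by (rule division_module_of_vector_space[OF V(1,2)])
  obtain B where B: "module_basis \<FF> V B" "vs_dim \<FF> V = |B|" using vs_dim_basis by blast
  interpret infinite_dim_module \<FF> V B
    using B V(3) by unfold_locales (simp_all add: cinfinite_def Field_card_of)
  interpret I: maximalideal I E by (rule I_maximal)
  obtain p q s where "matrix_like_ring E p q s" using End_matrix_like[OF infinite_B] by blast
  then interpret E: matrix_like_ring E p q s .
  interpret Q: matrix_like_ring "E Quot I" "\<lambda>i. I +>\<^bsub>E\<^esub> p i" "\<lambda>i. I +>\<^bsub>E\<^esub> q i" "I +>\<^bsub>E\<^esub> s"
    by (rule E.quotient_matrix_like[OF I.ideal_axioms]) (use I.I_notcarr in blast)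
  note sum = Q.sum_of_three_nilpotent_subrings
  show "let E = End_ring \<FF> V; I = small_image_ideal \<FF> V; Q = E Quot I in
           maximalideal I E \<and> (\<forall>J. maximalideal J E \<longrightarrow> J = I) \<and>
           simple_ring Q \<and>
           sum_of_three_nilpotent_subrings 3 Q \<and>
           (\<exists>K L M. braceable_subtruss K (ring_truss Q) \<and>
              braceable_subtruss L (ring_truss Q) \<and>
              braceable_subtruss M (ring_truss Q) \<and>
              carrier Q = heap_set (ring_truss Q) K L M)"
    unfolding Let_def
    using I_maximal I_unique_maximal I.quotient_simple sum Q.sum_of_three_braceable_subtrusses[OF sum]
    by blast
qed

end
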